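(* Let $g\in L^2(\mathbb{R})$ have the properties that the functions $x\mapsto g(x)$ and $x\mapsto g(-x)$ are both ultimately positive and ultimately decreasing, and let $\Lambda=\{(\alpha_k,\beta_k)\}_{k=0}^3\subseteq\mathbb{R}^2$ be a set of four distinct points. Then the finite Gabor system $\mathcal{G}(g,\Lambda)=\{e^{2\pi i\beta_kx}g(x-\alpha_k)\}_{k=0}^3$ is linearly independent in $L^2(\mathbb{R})$.
   Context: A property holds ultimately for a function if it holds on some interval $(x_0,\infty)$; "decreasing" is not necessarily strict. Linear independence of $\mathcal{G}(g,\Lambda)$ means: if $c_0,\dots,c_3\in\mathbb{C}$ and $\sum_{k=0}^3 c_k e^{2\pi i\beta_kx}g(x-\alpha_k)=0$ for almost every $x\in\mathbb{R}$, then all $c_k=0$. *)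

theory Defs
  imports "HOL-Analysis.Analysis"
begin

(* Functions stand for their classes modulo null sets in L^2(R). *)
definition square_integrable :: "(real \<Rightarrow> complex) \<Rightarrow> bool" where
  "square_integrable g \<longleftrightarrow>
     g \<in> borel_measurable lebesgue \<and> integrable lebesgue (\<lambda>x. (cmod (g x))\<^sup>2)"

(* Positivity and monotonicity of a complex-valued function on a half-line include
   the requirement that it is real-valued there. *)
definition ultimately_positive :: "(real \<Rightarrow> complex) \<Rightarrow> bool" where
  "ultimately_positive f \<longleftrightarrow> (\<exists>x0. \<forall>x>x0. f x \<in> \<real> \<and> 0 < Re (f x))"

definition ultimately_decreasing :: "(real \<Rightarrow> complex) \<Rightarrow> bool" where
  "ultimately_decreasing f \<longleftrightarrow>
     (\<exists>x0. (\<forall>x>x0. f x \<in> \<real>) \<and> antimono_on {x0<..} (\<lambda>x. Re (f x)))"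

definition gabor_atom :: "(real \<Rightarrow> complex) \<Rightarrow> real \<Rightarrow> real \<Rightarrow> real \<Rightarrow> complex" where
  "gabor_atom g a b x = exp (2 * of_real pi * \<i> * of_real b * of_real x) * g (x - a)"

(* Linear independence in L^2(R), where being zero means being zero almost everywhere,
   of the family indexed by K. *)
definition gabor_independent ::
  "(real \<Rightarrow> complex) \<Rightarrow> (nat \<Rightarrow> real) \<Rightarrow> (nat \<Rightarrow> real) \<Rightarrow> nat set \<Rightarrow> bool" where
  "gabor_independent g \<alpha> \<beta> K \<longleftrightarrow>
     (\<forall>c :: nat \<Rightarrow> complex.
        (AE x in lebesgue. (\<Sum>k\<in>K. c k * gabor_atom g (\<alpha> k) (\<beta> k) x) = 0)
          \<longrightarrow> (\<forall>k\<in>K. c k = 0))"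

end

theory Submission
  imports Defs "HOL-Complex_Analysis.Complex_Analysis" "HOL-Real_Asymp.Real_Asymp"
begin

text \<open>Suppose \<open>\<Sum>k. C\<^sub>k(x) g(x - \<alpha>\<^sub>k) = 0\<close> almost everywhere, with
  \<open>C\<^sub>k(x) = c\<^sub>k exp (2\<pi>i \<beta>\<^sub>k x)\<close>.

  If the frequencies of the nonzero coefficients agree, this is a relation between translates of
  \<open>g\<close>. The two one-sided Laplace transforms of \<open>g\<close> are then, up to sign, the same quotient
  \<open>E / P\<close> of an entire function by an exponential polynomial, and square integrability bounds it by
  \<open>C / sqrt \<bar>Re s\<bar>\<close>. This growth excludes poles and forces \<open>E = 0\<close> by the maximum principle, although
  the transform of a positive function on a half-line is positive.

  Otherwise let \<open>\<beta>\<^sub>a\<close> and \<open>\<beta>\<^sub>d\<close> be the extreme frequencies. The phases are almost periodic, and the order of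
  the translates near \<open>+\<infinity>\<close> is opposite to the one near \<open>-\<infinity>\<close>. Hence, whenever
  \<open>C\<^sub>a\<close> and \<open>C\<^sub>d\<close> are parallel, so is \<open>C\<^sub>b + C\<^sub>p\<close> for the other two indices. These points form an
  arithmetic progression with step \<open>1 / (2 (\<beta>\<^sub>d - \<beta>\<^sub>a))\<close>, too dense for the zeros of a combination of
  lower frequencies unless it vanishes identically, which the same order argument excludes.
  What remains is \<open>\<beta>\<^sub>p = \<beta>\<^sub>a\<close>, \<open>\<beta>\<^sub>b = \<beta>\<^sub>d\<close>, where two distinct translates of \<open>g\<close> must
  agree near infinity.\<close>

section \<open>Almost periods and tones\<close>

lemma AE_lebesgue_open_witness:
  fixes S :: "real set"
  assumes "AE x in lebesgue. P x" "open S" "S \<noteq> {}"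
  obtains x where "x \<in> S" "P x"
proof -
  have "\<exists>x\<in>S. P x"
  proof (rule ccontr)
    assume "\<not> (\<exists>x\<in>S. P x)"
    then have sub: "S \<subseteq> {x \<in> space lebesgue. \<not> P x}" by auto
    obtain N where N: "N \<in> null_sets lebesgue" "{x \<in> space lebesgue. \<not> P x} \<subseteq> N"
      using assms(1) unfolding eventually_ae_filter by blast
    have "negligible N" using N(1) by (simp add: negligible_iff_null_sets)
    then have "negligible S" using sub N(2) negligible_subset by (metis subset_trans)
    then show False using assms open_not_negligible by blast
  qed
  then show ?thesis using that by blast
qed

section \<open>Almost periods common to finitely many frequencies\<close>

lemma cmod_cis_diff_le: "cmod (cis a - cis b) \<le> \<bar>a - b\<bar>"
proof -
  have "cmod (cis a - cis b) = cmod (cis b * (cis (a - b) - 1))"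
    by (simp add: right_diff_distrib cis_mult)
  also have "\<dots> = cmod (exp (\<i> * of_real (a - b)) - 1)"
    by (simp add: norm_mult cis_conv_exp)
  also have "\<dots> \<le> \<bar>a - b\<bar>"
    using abs_sin_x_le_abs_x[of "(a - b) / 2"] by (simp add: dist_exp_i_1 del: of_real_diff)
  finally show ?thesis .
qed

text \<open>Simultaneous Dirichlet approximation: one integer \<open>q\<close> brings all
  \<open>q * T' * \<beta> i\<close> close to integers. The factor \<open>T'\<close> makes the period
  \<open>q * T'\<close> exceed \<open>T\<close>, since \<open>q\<close> is at least 1.\<close>

lemma cis_almost_period:
  fixes \<beta> :: "nat \<Rightarrow> real"
  assumes "e > 0"
  obtains \<tau> where "\<tau> > T" "\<And>k. k < n \<Longrightarrow> cmod (cis (2 * pi * \<beta> k * \<tau>) - 1) < e"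
proof -
  obtain N where N: "N > 0" "2 * pi / e < real N"
  proof -
    obtain N where N: "2 * pi / e < real N" using reals_Archimedean2 by blast
    moreover have "2 * pi / e > 0" using assms by simp
    ultimately have "N > 0" by (metis gr0I of_nat_0 less_asym)
    with N that show thesis by blast
  qed
  define T' where "T' = \<bar>T\<bar> + 1"
  obtain q p where q: "0 < q" "\<And>i. i < n \<Longrightarrow> \<bar>of_int q * (T' * \<beta> i) - of_int (p i)\<bar> < 1 / N"
    using Dirichlet_approx_simult[OF N(1), of n "\<lambda>i. T' * \<beta> i"] by blast
  show ?thesis
  proof (rule that[of "of_int q * T'"])
    have "of_int q \<ge> (1::real)" using q(1) by simp
    then have "of_int q * T' \<ge> 1 * T'"
      by (intro mult_right_mono) (auto simp: T'_def)
    then show "T < of_int q * T'" by (auto simp: T'_def)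
  next
    fix k assume k: "k < n"
    have "cmod (cis (2 * pi * \<beta> k * (of_int q * T')) - 1)
        = cmod (cis (2 * pi * \<beta> k * (of_int q * T')) - cis (2 * pi * of_int (p k)))"
      by (simp add: cis_multiple_2pi)
    also have "\<dots> \<le> \<bar>2 * pi * \<beta> k * (of_int q * T') - 2 * pi * of_int (p k)\<bar>"
      by (rule cmod_cis_diff_le)
    also have "\<dots> = \<bar>2 * pi * (of_int q * (T' * \<beta> k) - of_int (p k))\<bar>"
      by (simp add: algebra_simps)
    also have "\<dots> = 2 * pi * \<bar>of_int q * (T' * \<beta> k) - of_int (p k)\<bar>"
      by (simp add: abs_mult)
    also have "\<dots> < 2 * pi * (1 / N)"
      using q(2)[OF k] by (intro mult_strict_left_mono) auto
    also have "\<dots> < e" using N assms by (simp add: field_simps)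
    finally show "cmod (cis (2 * pi * \<beta> k * (of_int q * T')) - 1) < e" .
  qed
qed

section \<open>Zeros of tones on an arithmetic progression\<close>

text \<open>For \<open>m > 0\<close> one step turns the tone by an angle strictly between 0 and pi.
  A nonzero complex number cannot be real both before and after such a turn.\<close>

lemma Im_tone_zero:
  assumes m: "0 \<le> m" "m < N"
    and "Im (z * cis (2 * pi * m * \<theta>)) = 0" "Im (z * cis (2 * pi * m * (\<theta> + 1 / (2 * N)))) = 0"
  shows "Im (z * cis (2 * pi * m * x)) = 0"
proof (cases "m = 0")
  case True
  with assms show ?thesis by simp
next
  case False
  define w where "w = z * cis (2 * pi * m * \<theta>)"
  have "z * cis (2 * pi * m * (\<theta> + 1 / (2 * N))) = w * cis (2 * pi * m * (1 / (2 * N)))"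
    by (simp add: w_def cis_mult distrib_left mult.assoc)
  also have "2 * pi * m * (1 / (2 * N)) = pi * (m / N)" by simp
  finally have "Im (w * cis (pi * (m / N))) = 0" using assms(4) by simp
  moreover have "Im w = 0" using assms(3) by (simp add: w_def)
  moreover have "sin (pi * (m / N)) > 0"
    using m False by (intro sin_gt_zero) (auto simp: field_simps)
  ultimately have "w = 0" by (auto simp: complex_eq_iff)
  then show ?thesis by (simp add: w_def)
qed

text \<open>The second difference with step \<open>1 / (2 * N)\<close> acts on the tone of frequency \<open>m\<close> as
  multiplication by \<open>2 * cos (pi * m / N)\<close>, which separates the frequencies in \<open>{0..<N}\<close>.\<close>

lemma Im_two_tones_zero:
  assumes m: "0 \<le> m" "m < N" and n: "0 \<le> n" "n < N"
    and zero: "\<And>j::int. Im (z * cis (2 * pi * m * (\<theta> + j / (2 * N))))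
                 + Im (y * cis (2 * pi * n * (\<theta> + j / (2 * N)))) = 0"
  shows "Im (z * cis (2 * pi * m * x)) + Im (y * cis (2 * pi * n * x)) = 0"
proof (cases "m = n")
  case True
  have "Im ((z + y) * cis (2 * pi * m * x)) = 0"
  proof (rule Im_tone_zero[OF m])
    show "Im ((z + y) * cis (2 * pi * m * \<theta>)) = 0"
      using zero[of 0] True by (simp add: algebra_simps)
    show "Im ((z + y) * cis (2 * pi * m * (\<theta> + 1 / (2 * N)))) = 0"
      using zero[of 1] True by (simp add: algebra_simps)
  qed
  with True show ?thesis by (simp add: algebra_simps)
next
  case False
  define h where "h = 1 / (2 * N)"
  define f where "f = (\<lambda>m z (j::int). Im (z * cis (2 * pi * m * (\<theta> + j * h))))"
  have rec: "f m z (j + 1) + f m z (j - 1) = 2 * cos (pi * (m / N)) * f m z j" for m z j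
  proof -
    define t where "t = 2 * pi * m * (\<theta> + j * h)"
    have h: "2 * pi * m * h = pi * (m / N)" by (simp add: h_def)
    have 1: "2 * pi * m * (\<theta> + of_int (j + 1) * h) = t + pi * (m / N)"
      unfolding h[symmetric] t_def by (simp add: algebra_simps)
    have 2: "2 * pi * m * (\<theta> + of_int (j - 1) * h) = t - pi * (m / N)"
      unfolding h[symmetric] t_def by (simp add: algebra_simps)
    show ?thesis
      unfolding f_def 1 2 t_def[symmetric]
      by (simp add: sin_add sin_diff cos_add cos_diff algebra_simps)
  qed
  have s: "f m z j + f n y j = 0" for j
    using zero[of j] by (simp add: f_def h_def)
  have fm: "f m z j = 0" for j
  proof -
    have "2 * cos (pi * (m / N)) * f m z j + 2 * cos (pi * (n / N)) * f n y j = 0"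
      using rec[of m z j] rec[of n y j] s[of "j + 1"] s[of "j - 1"] by linarith
    moreover have "f n y j = - f m z j" using s[of j] by linarith
    ultimately have "(cos (pi * (m / N)) - cos (pi * (n / N))) * f m z j = 0"
      by (simp add: algebra_simps)
    moreover have "cos (pi * (m / N)) \<noteq> cos (pi * (n / N))"
    proof
      have range: "0 \<le> pi * (k / N)" "pi * (k / N) \<le> pi" if "0 \<le> k" "k < N" for k
      proof -
        have "k / N \<le> 1" using that by simp
        from mult_left_mono[OF this, of pi] show "pi * (k / N) \<le> pi" by simp
      qed (use that in auto)
      assume "cos (pi * (m / N)) = cos (pi * (n / N))"
      then have "pi * (m / N) = pi * (n / N)"
        using cos_inj_pi[OF range[OF m] range[OF n]] by blast
      then have "m / N = n / N" by simp
      then show False using False m by simp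
    qed
    ultimately show ?thesis by simp
  qed
  have fn: "f n y j = 0" for j using s[of j] fm[of j] by simp
  have "Im (z * cis (2 * pi * m * x)) = 0"
    using Im_tone_zero[OF m, of z \<theta> x] fm[of 0] fm[of 1] by (simp add: f_def h_def)
  moreover have "Im (y * cis (2 * pi * n * x)) = 0"
    using Im_tone_zero[OF n, of y \<theta> x] fn[of 0] fn[of 1] by (simp add: f_def h_def)
  ultimately show ?thesis by simp
qed

section \<open>Relations with different frequencies\<close>

text \<open>Here \<open>u k x\<close> stands for \<open>g (x - \<alpha> k)\<close>.\<close>

locale ordered_relation =
  fixes u :: "nat \<Rightarrow> real \<Rightarrow> real" and c :: "nat \<Rightarrow> complex" and \<alpha> \<beta> :: "nat \<Rightarrow> real" and X :: real
  assumes pos: "\<bar>x\<bar> > X \<Longrightarrow> u k x > 0"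
    and right: "x > X \<Longrightarrow> \<alpha> i \<le> \<alpha> j \<Longrightarrow> u i x \<le> u j x"
    and left: "- x > X \<Longrightarrow> \<alpha> i \<le> \<alpha> j \<Longrightarrow> u j x \<le> u i x"
    and rel: "AE x in lebesgue. \<bar>x\<bar> > X \<longrightarrow>
      (\<Sum>k<4. c k * cis (2 * pi * \<beta> k * x) * of_real (u k x)) = 0"
begin

text \<open>The imaginary part of \<open>C\<^sub>i * cnj C\<^sub>j\<close>, which vanishes when the two phases are parallel.\<close>

definition J :: "nat \<Rightarrow> nat \<Rightarrow> real \<Rightarrow> real" where
  "J i j x = Im (c i * cnj (c j) * cis (2 * pi * (\<beta> i - \<beta> j) * x))"

lemma J_shift_le:
  assumes "cmod (cis (2 * pi * \<beta> i * t) - 1) < e" "cmod (cis (2 * pi * \<beta> j * t) - 1) < e"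
  shows "\<bar>J i j (x + t) - J i j x\<bar> \<le> cmod (c i) * cmod (c j) * (2 * e)"
proof -
  define z w where "z = cis (2 * pi * \<beta> i * t)" and "w = cis (2 * pi * \<beta> j * t)"
  have zw: "cis (2 * pi * (\<beta> i - \<beta> j) * t) = z * cnj w"
    by (simp add: z_def w_def cis_cnj cis_mult algebra_simps)
  have "z * cnj w - 1 = (z - 1) * cnj w + cnj (w - 1)"
    by (simp add: algebra_simps)
  then have "cmod (z * cnj w - 1) \<le> cmod ((z - 1) * cnj w) + cmod (cnj (w - 1))"
    by (metis norm_triangle_ineq)
  also have "\<dots> \<le> 2 * e"
    using assms unfolding z_def[symmetric] w_def[symmetric] complex_mod_cnj norm_mult
    by (simp add: w_def)
  finally have b: "cmod (z * cnj w - 1) \<le> 2 * e" .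
  have "J i j (x + t) - J i j x
      = Im (c i * cnj (c j) * cis (2 * pi * (\<beta> i - \<beta> j) * x) * (cis (2 * pi * (\<beta> i - \<beta> j) * t) - 1))"
    by (simp add: J_def right_diff_distrib cis_mult mult.assoc distrib_left)
  also have "\<bar>\<dots>\<bar> \<le> cmod (c i * cnj (c j) * cis (2 * pi * (\<beta> i - \<beta> j) * x)
      * (cis (2 * pi * (\<beta> i - \<beta> j) * t) - 1))"
    by (rule abs_Im_le_cmod)
  also have "\<dots> = cmod (c i) * cmod (c j) * cmod (z * cnj w - 1)"
    by (simp add: norm_mult zw)
  also have "\<dots> \<le> cmod (c i) * cmod (c j) * (2 * e)"
    by (intro mult_left_mono b) auto
  finally show ?thesis .
qed

lemma continuous_J: "isCont (J i j) x"
proof -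
  have "continuous_on UNIV (J i j)"
    unfolding J_def by (intro continuous_intros)
  then show ?thesis by (simp add: continuous_on_eq_continuous_at)
qed

text \<open>By recurrence, every phase configuration reappears arbitrarily far out, on both sides.\<close>

lemma recurrent_point:
  assumes P: "AE x in lebesgue. P x" and \<eta>: "\<eta> > 0" and s: "s \<in> {1, - 1::real}"
  obtains x where "s * x > X" "P x"
    "\<And>i j. i < 4 \<Longrightarrow> j < 4 \<Longrightarrow> \<bar>J i j x - J i j \<theta>\<bar> < \<eta>"
proof -
  have "\<forall>\<^sub>F y in nhds \<theta>. \<forall>i\<in>{..<4}. \<forall>j\<in>{..<4}. \<bar>J i j y - J i j \<theta>\<bar> < \<eta> / 2"
  proof (intro eventually_ball_finite ballI)
    fix i j :: nat
    have "(J i j \<longlongrightarrow> J i j \<theta>) (nhds \<theta>)"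
      using continuous_J[of \<theta> i j] by (simp add: isCont_def tendsto_nhds_iff)
    from tendstoD[OF this, of "\<eta> / 2"]
    show "\<forall>\<^sub>F y in nhds \<theta>. \<bar>J i j y - J i j \<theta>\<bar> < \<eta> / 2"
      using \<eta> by (simp add: dist_real_def)
  qed auto
  then obtain d where d: "d > 0"
    "\<And>y i j. \<bar>y - \<theta>\<bar> < d \<Longrightarrow> i < 4 \<Longrightarrow> j < 4 \<Longrightarrow> \<bar>J i j y - J i j \<theta>\<bar> < \<eta> / 2"
    unfolding eventually_nhds_metric dist_real_def by (auto simp: dist_real_def)
  define C where "C = (\<Sum>i<4. cmod (c i))"
  have C: "cmod (c i) \<le> C" if "i < 4" for i
    unfolding C_def using that by (intro member_le_sum) auto
  have C0: "C \<ge> 0" unfolding C_def by (intro sum_nonneg) auto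
  \<comment> \<open>A shift then changes each \<open>J i j\<close> by less than
    \<open>\<eta> / 2\<close>; the summand 1 avoids division by zero when all coefficients
    vanish.\<close>
  define e where "e = \<eta> / (4 * (C * C + 1))"
  have CC: "C * C + 1 > 0" using C0 by (simp add: add_nonneg_pos)
  then have e: "e > 0" using \<eta> by (simp add: e_def)
  have "C * C * (2 * e) < (C * C + 1) * (2 * e)" using e by simp
  also have "\<dots> = \<eta> / 2" using CC by (simp add: e_def field_simps)
  finally have e2: "C * C * (2 * e) < \<eta> / 2" .
  obtain \<tau> where \<tau>: "\<tau> > \<bar>X\<bar> + \<bar>\<theta>\<bar> + d"
    "\<And>k. k < 4 \<Longrightarrow> cmod (cis (2 * pi * \<beta> k * \<tau>) - 1) < e"
    using cis_almost_period[OF e] by metis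
  \<comment> \<open>A shift to the left conjugates the phase factor, so the same
    \<open>\<tau>\<close> serves both ends.\<close>
  have s\<tau>: "cmod (cis (2 * pi * \<beta> k * (s * \<tau>)) - 1) < e" if "k < 4" for k
  proof (cases "s = 1")
    case False
    then have "cis (2 * pi * \<beta> k * (s * \<tau>)) - 1 = cnj (cis (2 * pi * \<beta> k * \<tau>) - 1)"
      using s by (simp add: cis_cnj)
    then show ?thesis using \<tau>(2)[OF that] by (metis complex_mod_cnj)
  qed (use \<tau>(2)[OF that] in simp)
  \<comment> \<open>\<open>P\<close> holds only almost everywhere, so
    \<open>\<theta> + s * \<tau>\<close> is replaced by a point nearby; continuity of
    \<open>J\<close> absorbs the difference.\<close>
  obtain x where x: "x \<in> ball (\<theta> + s * \<tau>) d" "P x"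
    using AE_lebesgue_open_witness[OF P, of "ball (\<theta> + s * \<tau>) d"] d(1) by auto
  show ?thesis
  proof (rule that[of x])
    show "s * x > X"
      using x(1) s \<tau>(1) by (auto simp: dist_real_def)
    fix i j :: nat assume ij: "i < 4" "j < 4"
    define y where "y = x - s * \<tau>"
    have y: "\<bar>y - \<theta>\<bar> < d" using x(1) by (auto simp: y_def dist_real_def)
    have "\<bar>J i j (y + s * \<tau>) - J i j y\<bar> \<le> cmod (c i) * cmod (c j) * (2 * e)"
      by (intro J_shift_le s\<tau> ij)
    also have "\<dots> \<le> C * C * (2 * e)"
      using e C ij C0 by (intro mult_mono) auto
    finally have "\<bar>J i j x - J i j y\<bar> \<le> C * C * (2 * e)" by (simp add: y_def)
    then show "\<bar>J i j x - J i j \<theta>\<bar> < \<eta>"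
      using d(2)[OF y ij] e2 by linarith
  qed (rule x(2))
qed

end

section \<open>The sign of \<open>J d a\<close> for the extreme frequencies\<close>

text \<open>The indices \<open>a\<close> and \<open>d\<close> are meant to carry the extreme frequencies.\<close>

locale ordered_relation4 = ordered_relation +
  fixes a b p d :: nat
  assumes idx: "distinct [a, b, p, d]" "{..<4} = {a, b, p, d}"
    and nz: "c a \<noteq> 0" "c d \<noteq> 0"
    and freq: "\<beta> a \<noteq> \<beta> d"
begin

lemma idx_less: "a < 4" "b < 4" "p < 4" "d < 4"
  using idx(2) by auto

text \<open>Multiplying the relation by the conjugate of the phase of index \<open>a\<close> makes
  the term of \<open>a\<close> real, so it drops out of the imaginary part.\<close>

lemma J_relation:
  "AE x in lebesgue. \<bar>x\<bar> > X \<longrightarrow> J b a x * u b x + J p a x * u p x + J d a x * u d x = 0"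
  using rel
proof eventually_elim
  case (elim x)
  show ?case
  proof
    assume "\<bar>x\<bar> > X"
    let ?C = "\<lambda>k. c k * cis (2 * pi * \<beta> k * x)"
    have 0: "?C a * u a x + ?C b * u b x + ?C p * u p x + ?C d * u d x = 0"
      using elim \<open>\<bar>x\<bar> > X\<close> idx(1) unfolding idx(2) by (simp add: add.assoc)
    have J: "J k a x = Im (?C k * cnj (?C a))" for k
      by (simp add: J_def cis_cnj cis_mult algebra_simps)
    have "Im ((?C a * u a x + ?C b * u b x + ?C p * u p x + ?C d * u d x) * cnj (?C a))
        = J b a x * u b x + J p a x * u p x + J d a x * u d x"
      unfolding J by (simp add: algebra_simps)
    then show "J b a x * u b x + J p a x * u p x + J d a x * u d x = 0"
      using 0 by simp
  qed
qed

text \<open>Passing from one end to the other reverses the order of the translates, so any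
  prescribed inequality between two of them holds near one of the ends.\<close>

lemma end_with_order:
  obtains s :: real where "s \<in> {1, -1}" "\<And>x. s * x > X \<Longrightarrow> u i x \<le> u j x"
proof (cases "\<alpha> i \<le> \<alpha> j")
  case True
  then show ?thesis using that[of 1] right by auto
next
  case False
  then show ?thesis using that[of "-1"] left by auto
qed

lemma abs_gt: "s * x > X \<Longrightarrow> s \<in> {1, - 1} \<Longrightarrow> \<bar>x\<bar> > X" for x :: real
  by auto

text \<open>If, say, \<open>s * J b a \<theta> > 0\<close>, go to the end where \<open>u p \<le> u b\<close>: there
  \<open>s * (J b a * u b + J p a * u p) \<ge> s * (J b a + J p a) * u p > 0\<close>.\<close>

lemma no_strict_sign:
  assumes "s \<noteq> 0" "s * J d a \<theta> > 0" "s * (J b a \<theta> + J p a \<theta>) > 0"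
  shows False
proof -
  have main: False
    if k: "{k, l} = {b, p}" "k \<noteq> l" and sk: "s * J k a \<theta> > 0" for k l
  proof -
    have kl: "k < 4" "l < 4" using k idx_less by (auto simp: doubleton_eq_iff)
    have sum: "J k a x + J l a x = J b a x + J p a x" for x
      using k by (auto simp: doubleton_eq_iff)
    obtain t :: real where t: "t \<in> {1, - 1}" "\<And>x. t * x > X \<Longrightarrow> u l x \<le> u k x"
      using end_with_order by metis
    \<comment> \<open>A quarter of the smallest margin: at most two errors are added, which cannot
      change any of the three signs.\<close>
    define \<eta> where "\<eta> = Min {s * J d a \<theta>, s * J k a \<theta>, s * (J b a \<theta> + J p a \<theta>)} / (4 * \<bar>s\<bar>)"
    have \<eta>: "\<eta> > 0" "4 * \<bar>s\<bar> * \<eta> \<le> s * J d a \<theta>" "4 * \<bar>s\<bar> * \<eta> \<le> s * J k a \<theta>"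
      "4 * \<bar>s\<bar> * \<eta> \<le> s * (J b a \<theta> + J p a \<theta>)"
      using assms sk by (auto simp: \<eta>_def)
    obtain x where x: "t * x > X"
      "\<bar>x\<bar> > X \<longrightarrow> J b a x * u b x + J p a x * u p x + J d a x * u d x = 0"
      "\<And>i j. i < 4 \<Longrightarrow> j < 4 \<Longrightarrow> \<bar>J i j x - J i j \<theta>\<bar> < \<eta>"
      using recurrent_point[OF J_relation \<eta>(1) t(1)] by blast
    have near: "\<bar>s * J i a x - s * J i a \<theta>\<bar> < \<bar>s\<bar> * \<eta>" if "i < 4" for i
    proof -
      have "\<bar>s * J i a x - s * J i a \<theta>\<bar> = \<bar>s\<bar> * \<bar>J i a x - J i a \<theta>\<bar>"
        by (simp flip: abs_mult right_diff_distrib)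
      also have "\<dots> < \<bar>s\<bar> * \<eta>"
        using x(3)[OF that idx_less(1)] assms(1) by simp
      finally show ?thesis .
    qed
    have se: "\<bar>s\<bar> * \<eta> > 0" using \<eta>(1) assms(1) by simp
    have 1: "s * J d a x > 0" using near[OF idx_less(4)] \<eta>(2) se by linarith
    have 2: "s * J k a x > 0" using near[OF kl(1)] \<eta>(3) se by linarith
    have 3: "s * J b a x + s * J p a x > 0"
      using near[OF idx_less(2)] near[OF idx_less(3)] \<eta>(4) se by (simp add: distrib_left)
    have X: "\<bar>x\<bar> > X" using abs_gt x(1) t(1) by blast
    have "0 = s * (J b a x * u b x + J p a x * u p x + J d a x * u d x)"
      using x(2) X by simp
    also have "\<dots> = s * J k a x * u k x + s * J l a x * u l x + s * J d a x * u d x"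
      using k by (auto simp: doubleton_eq_iff algebra_simps)
    also have "\<dots> \<ge> s * J k a x * u l x + s * J l a x * u l x + s * J d a x * u d x"
      using mult_left_mono[OF t(2)[OF x(1)], of "s * J k a x"] 2 by simp
    also have "s * J k a x * u l x + s * J l a x * u l x = (s * J b a x + s * J p a x) * u l x"
      using sum[of x] by (metis distrib_left distrib_right)
    also have "\<dots> + s * J d a x * u d x > 0"
      using add_pos_pos[OF mult_pos_pos[OF 3 pos[OF X]] mult_pos_pos[OF 1 pos[OF X]]] .
    finally show False by simp
  qed
  have "s * J b a \<theta> > 0 \<or> s * J p a \<theta> > 0"
    using assms(3) by (simp add: distrib_left) linarith
  then show False
    using main[of b p] main[of p b] idx(1) by auto
qed

text \<open>At a zero of \<open>J d a\<close> the product \<open>D\<close> of the phases is real and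
  nonzero, so a further rotation contributes an imaginary part only through its sine.\<close>

lemma J_eq_sin: 
  assumes "J d a \<theta> = 0"
  obtains r where "r \<noteq> 0" "\<And>h. J d a (\<theta> + h) = r * sin (2 * pi * (\<beta> d - \<beta> a) * h)"
proof -
  define D where "D = c d * cnj (c a) * cis (2 * pi * (\<beta> d - \<beta> a) * \<theta>)"
  have D: "Im D = 0" "D \<noteq> 0" using assms nz by (auto simp: D_def J_def)
  then have "Re D \<noteq> 0" by (simp add: complex_eq_iff)
  moreover have "J d a (\<theta> + h) = Re D * sin (2 * pi * (\<beta> d - \<beta> a) * h)" for h
  proof -
    have "J d a (\<theta> + h) = Im (D * cis (2 * pi * (\<beta> d - \<beta> a) * h))"
      by (simp add: J_def D_def cis_mult distrib_left mult.assoc)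
    then show ?thesis using D(1) by simp
  qed
  ultimately show ?thesis using that by blast
qed

text \<open>\<open>J d a\<close> changes sign at its zero \<open>\<theta>\<close>. A nonzero sum
  \<open>J b a + J p a\<close> would keep its sign nearby and share it with \<open>J d a\<close> on
  one side of \<open>\<theta>\<close>, which \<open>no_strict_sign\<close> excludes.\<close>

lemma J_cancel:
  assumes "J d a \<theta> = 0"
  shows "J b a \<theta> + J p a \<theta> = 0"
proof (rule ccontr)
  define s where "s = sgn (J b a \<theta> + J p a \<theta>)"
  assume "\<not> ?thesis"
  then have s: "s \<noteq> 0" "s * (J b a \<theta> + J p a \<theta>) > 0"
    by (auto simp: s_def sgn_if)
  obtain r where r: "r \<noteq> 0" "\<And>h. J d a (\<theta> + h) = r * sin (2 * pi * (\<beta> d - \<beta> a) * h)"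
    using J_eq_sin[OF assms] by blast
  define w where "w = s * r * (\<beta> d - \<beta> a)"
  have w: "w \<noteq> 0" using s r freq by (simp add: w_def)
  have "((\<lambda>y. s * (J b a y + J p a y)) \<longlongrightarrow> s * (J b a \<theta> + J p a \<theta>)) (nhds \<theta>)"
    by (intro tendsto_intros) (use continuous_J in \<open>auto simp: isCont_def tendsto_nhds_iff\<close>)
  then have "\<forall>\<^sub>F y in nhds \<theta>. s * (J b a y + J p a y) > 0"
    using order_tendstoD(1) s(2) by blast
  then obtain e where e: "e > 0" "\<And>y. \<bar>y - \<theta>\<bar> < e \<Longrightarrow> s * (J b a y + J p a y) > 0"
    unfolding eventually_nhds_metric dist_real_def by blast
  \<comment> \<open>The first bound keeps the sign of the sum, the second keeps the angle of the
    sine at most pi/2.\<close>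
  define t where "t = min (e / 2) (1 / (4 * \<bar>\<beta> d - \<beta> a\<bar>))"
  have t: "t > 0" "t < e" using e freq by (auto simp: t_def min_def)
  have t2: "2 * pi * \<bar>\<beta> d - \<beta> a\<bar> * t < pi"
  proof -
    have "t \<le> 1 / (4 * \<bar>\<beta> d - \<beta> a\<bar>)" by (simp add: t_def)
    then have "2 * pi * \<bar>\<beta> d - \<beta> a\<bar> * t \<le> 2 * pi * \<bar>\<beta> d - \<beta> a\<bar> * (1 / (4 * \<bar>\<beta> d - \<beta> a\<bar>))"
      by (intro mult_left_mono) auto
    also have "\<dots> = pi / 2" using freq by simp
    finally show ?thesis using pi_gt_zero by linarith
  qed
  have sp: "sin (2 * pi * \<bar>\<beta> d - \<beta> a\<bar> * t) > 0"
    using t(1) t2 freq by (intro sin_gt_zero) auto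
  \<comment> \<open>The sign of \<open>w\<close> selects the side of \<open>\<theta>\<close> on
    which \<open>s * J d a\<close> is positive.\<close>
  define h where "h = sgn w * t"
  have "s * J d a (\<theta> + h) = (s * r) * sin (2 * pi * (\<beta> d - \<beta> a) * h)"
    by (simp add: r(2))
  also have "sin (2 * pi * (\<beta> d - \<beta> a) * h) = sgn w * sgn (\<beta> d - \<beta> a) * sin (2 * pi * \<bar>\<beta> d - \<beta> a\<bar> * t)"
  proof -
    have "2 * pi * (\<beta> d - \<beta> a) * h = sgn w * (2 * pi * (sgn (\<beta> d - \<beta> a) * \<bar>\<beta> d - \<beta> a\<bar>) * t)"
      unfolding sgn_mult_abs by (simp add: h_def)
    also have "\<dots> = (sgn w * sgn (\<beta> d - \<beta> a)) * (2 * pi * \<bar>\<beta> d - \<beta> a\<bar> * t)"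
      by (simp only: mult_ac)
    finally have "2 * pi * (\<beta> d - \<beta> a) * h = \<dots>" .
    moreover have "sgn w * sgn (\<beta> d - \<beta> a) \<in> {1, - 1}"
      using w freq by (simp add: sgn_if)
    moreover have "sin (v * y) = v * sin y" if "v \<in> {1, - 1}" for v y :: real
      using that by auto
    ultimately show ?thesis by presburger
  qed
  also have "(s * r) * \<dots> = (sgn w * (sgn (\<beta> d - \<beta> a) * (s * r))) * sin (2 * pi * \<bar>\<beta> d - \<beta> a\<bar> * t)"
    by simp
  also have "\<dots> > 0"
  proof (rule mult_pos_pos[OF _ sp])
    have "sgn (v * y) * (sgn y * v) > 0" if "v \<noteq> 0" "y \<noteq> 0" for v y :: real
      unfolding sgn_mult using that by (auto simp: sgn_if)
    from this[of "s * r" "\<beta> d - \<beta> a"] show "sgn w * (sgn (\<beta> d - \<beta> a) * (s * r)) > 0"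
      using s r freq by (simp add: w_def)
  qed
  finally have "s * J d a (\<theta> + h) > 0" .
  moreover have "s * (J b a (\<theta> + h) + J p a (\<theta> + h)) > 0"
    using t w by (intro e(2)) (auto simp: h_def abs_mult abs_sgn_eq)
  ultimately show False using no_strict_sign[OF s(1)] by blast
qed

text \<open>As \<open>\<beta> a\<close> and \<open>\<beta> d\<close> differ, the relative phase of
  the two extreme terms runs through the whole circle.\<close>

lemma exists_phase:
  assumes "cmod z = 1"
  obtains \<theta> where "cis (2 * pi * (\<beta> d - \<beta> a) * \<theta>) * (c d * cnj (c a)) = z * of_real (cmod (c d) * cmod (c a))"
proof -
  define D where "D = c d * cnj (c a)"
  have D: "D = of_real (cmod D) * cis (Arg D)"
    by (metis rcis_cmod_Arg rcis_def)
  have z: "z = cis (Arg z)" using assms by (metis rcis_cmod_Arg rcis_def mult_1 of_real_1)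
  define \<theta> where "\<theta> = (Arg z - Arg D) / (2 * pi * (\<beta> d - \<beta> a))"
  have "2 * pi * (\<beta> d - \<beta> a) * \<theta> = Arg z - Arg D"
    using freq by (simp add: \<theta>_def)
  then have "cis (2 * pi * (\<beta> d - \<beta> a) * \<theta>) * D = cis (Arg z - Arg D) * D"
    by simp
  also have "\<dots> = cis (Arg z - Arg D) * (of_real (cmod D) * cis (Arg D))"
    by (rule arg_cong[OF D])
  also have "\<dots> = of_real (cmod D) * (cis (Arg z - Arg D) * cis (Arg D))"
    by (simp only: mult_ac)
  also have "\<dots> = z * of_real (cmod D)" using z by (simp add: cis_mult)
  finally show thesis using that by (simp add: D_def norm_mult)
qed

text \<open>With opposite coefficients the two middle terms combine to
  \<open>J k a * (u k - u l)\<close>, and the second factor is nonnegative at a suitable end. Where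
  \<open>J d a > 0\<close>, neither \<open>J b a\<close> nor \<open>J p a\<close> can then be
  positive; being opposite, both vanish, and \<open>J d a * u d = 0\<close> is absurd.\<close>

lemma J_not_cancel:
  assumes "\<And>\<theta>. J b a \<theta> + J p a \<theta> = 0"
  shows False
proof -
  have sgn0: "J k a \<theta> \<le> 0" if J: "J d a \<theta> > 0" and k: "{k, l} = {b, p}" "k \<noteq> l" for k l \<theta>
  proof (rule ccontr)
    assume "\<not> J k a \<theta> \<le> 0"
    then have Jk: "J k a \<theta> > 0" by simp
    have kl: "k < 4" "l < 4" using k idx_less by (auto simp: doubleton_eq_iff)
    obtain t :: real where t: "t \<in> {1, - 1}" "\<And>x. t * x > X \<Longrightarrow> u l x \<le> u k x"
      using end_with_order by metis
    define \<eta> where "\<eta> = min (J d a \<theta>) (J k a \<theta>)"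
    have \<eta>: "\<eta> > 0" using J Jk by (auto simp: \<eta>_def)
    obtain x where x: "t * x > X"
      "\<bar>x\<bar> > X \<longrightarrow> J b a x * u b x + J p a x * u p x + J d a x * u d x = 0"
      "\<And>i j. i < 4 \<Longrightarrow> j < 4 \<Longrightarrow> \<bar>J i j x - J i j \<theta>\<bar> < \<eta>"
      using recurrent_point[OF J_relation \<eta>(1) t(1)] by blast
    have X: "\<bar>x\<bar> > X" using abs_gt x(1) t(1) by blast
    have 1: "J d a x > 0" using x(3)[of d a] idx_less by (auto simp: \<eta>_def)
    have 2: "J k a x > 0" using x(3)[of k a] idx_less kl by (auto simp: \<eta>_def)
    have l: "J l a x = - J k a x"
      using assms[of x] k by (auto simp: doubleton_eq_iff)
    have "0 = J k a x * u k x + J l a x * u l x + J d a x * u d x"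
      using x(2) X k by (auto simp: doubleton_eq_iff)
    also have "\<dots> = J k a x * (u k x - u l x) + J d a x * u d x"
      by (simp add: l algebra_simps)
    also have "\<dots> > 0"
      using 1 2 t(2)[OF x(1)] pos[OF X] by (intro add_nonneg_pos mult_pos_pos mult_nonneg_nonneg) auto
    finally show False by simp
  qed
  have bp: "b \<noteq> p" using idx(1) by auto
  have zero: "J b a \<theta> = 0" "J p a \<theta> = 0" if "J d a \<theta> > 0" for \<theta>
    using sgn0[OF that, of b p] sgn0[OF that, of p b] bp assms[of \<theta>]
    by (auto simp: insert_commute)
  \<comment> \<open>This phase gives \<open>J d a\<close> its largest value.\<close>
  obtain \<theta> where th: "cis (2 * pi * (\<beta> d - \<beta> a) * \<theta>) * (c d * cnj (c a)) = \<i> * of_real (cmod (c d) * cmod (c a))"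
    using exists_phase[of \<i>] by auto
  have "J d a \<theta> = Im (cis (2 * pi * (\<beta> d - \<beta> a) * \<theta>) * (c d * cnj (c a)))"
    by (simp add: J_def mult.commute)
  also have "\<dots> = cmod (c d) * cmod (c a)"
    unfolding th by simp
  finally have J: "J d a \<theta> > 0"
    using nz by simp
  obtain x where x: "1 * x > X"
      "\<bar>x\<bar> > X \<longrightarrow> J b a x * u b x + J p a x * u p x + J d a x * u d x = 0"
      "\<And>i j. i < 4 \<Longrightarrow> j < 4 \<Longrightarrow> \<bar>J i j x - J i j \<theta>\<bar> < J d a \<theta>"
    using recurrent_point[OF J_relation J, of 1] by blast
  have 1: "J d a x > 0" using x(3)[of d a] idx_less by auto
  have X: "\<bar>x\<bar> > X" using x(1) by auto
  have "J d a x * u d x = 0" using x(2) X zero[OF 1] by simp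
  then show False using 1 pos[OF X, of d] by simp
qed

lemma half_period: "N \<noteq> 0 \<Longrightarrow> 2 * pi * N * (j / (2 * N)) = j * pi" for N j :: real
  by simp

text \<open>Aligning the extreme phases gives one zero, and the sine vanishes again after every half
  period.\<close>

lemma exists_J_zero:
  obtains \<theta> where "\<And>j::int. J d a (\<theta> + j / (2 * (\<beta> d - \<beta> a))) = 0"
proof -
  obtain \<theta> where th: "cis (2 * pi * (\<beta> d - \<beta> a) * \<theta>) * (c d * cnj (c a)) = 1 * of_real (cmod (c d) * cmod (c a))"
    using exists_phase[of 1] by auto
  have "J d a \<theta> = Im (cis (2 * pi * (\<beta> d - \<beta> a) * \<theta>) * (c d * cnj (c a)))"
    by (simp add: J_def mult.commute)
  also have "\<dots> = 0" unfolding th by simp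
  finally obtain r where r: "\<And>h. J d a (\<theta> + h) = r * sin (2 * pi * (\<beta> d - \<beta> a) * h)"
    using J_eq_sin by metis
  have "J d a (\<theta> + j / (2 * (\<beta> d - \<beta> a))) = 0" for j :: int
  proof -
    have "2 * pi * (\<beta> d - \<beta> a) * (j / (2 * (\<beta> d - \<beta> a))) = j * pi"
      using half_period[of "\<beta> d - \<beta> a"] freq by simp
    then show ?thesis by (simp add: r sin_times_pi_eq_0)
  qed
  then show thesis using that by blast
qed

text \<open>Measured from \<open>\<beta> a\<close>, both middle frequencies lie in
  \<open>{0..<N}\<close> for \<open>N = \<beta> d - \<beta> a\<close>. By \<open>J_cancel\<close>
  their sum vanishes on the zeros of \<open>J d a\<close>, hence identically by
  \<open>Im_two_tones_zero\<close>.\<close>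

lemma no_inner_frequencies:
  assumes "\<beta> a \<le> \<beta> b" "\<beta> b < \<beta> d" "\<beta> a \<le> \<beta> p" "\<beta> p < \<beta> d"
  shows False
proof (rule J_not_cancel)
  fix x
  obtain \<theta> where "\<And>j::int. J d a (\<theta> + j / (2 * (\<beta> d - \<beta> a))) = 0"
    using exists_J_zero by blast
  then have "J b a (\<theta> + j / (2 * (\<beta> d - \<beta> a))) + J p a (\<theta> + j / (2 * (\<beta> d - \<beta> a))) = 0" for j :: int
    using J_cancel by blast
  then show "J b a x + J p a x = 0"
    unfolding J_def
    by (rule Im_two_tones_zero[rotated 4, where N = "\<beta> d - \<beta> a"]) (use assms in simp_all)
qed

text \<open>The zeros lie on one arithmetic progression, which is countable; off it the relation may
  be divided by \<open>J d a\<close>.\<close>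

lemma AE_J_nonzero: "AE x in lebesgue. J d a x \<noteq> 0"
proof -
  obtain \<theta> where "\<And>j::int. J d a (\<theta> + j / (2 * (\<beta> d - \<beta> a))) = 0"
    using exists_J_zero by blast
  from this[of 0] have "J d a \<theta> = 0" by simp
  then obtain r where r: "r \<noteq> 0" "\<And>h. J d a (\<theta> + h) = r * sin (2 * pi * (\<beta> d - \<beta> a) * h)"
    using J_eq_sin by metis
  have "{x. J d a x = 0} \<subseteq> (\<lambda>j::int. \<theta> + j / (2 * (\<beta> d - \<beta> a))) ` UNIV"
  proof
    fix x assume "x \<in> {x. J d a x = 0}"
    then have "sin ((2 * (\<beta> d - \<beta> a) * (x - \<theta>)) * pi) = 0"
      using r(1) r(2)[of "x - \<theta>"] by (simp add: mult_ac)
    then obtain j where "2 * (\<beta> d - \<beta> a) * (x - \<theta>) = of_int j"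
      unfolding sin_times_pi_eq_0 by (elim Ints_cases)
    moreover have "t = k / (2 * N)" if "2 * N * t = k" "N \<noteq> 0" for N t k :: real
      using that by auto
    moreover have "\<beta> d - \<beta> a \<noteq> 0" using freq by simp
    ultimately have "x - \<theta> = j / (2 * (\<beta> d - \<beta> a))" by blast
    then have "x = \<theta> + j / (2 * (\<beta> d - \<beta> a))" by simp
    then show "x \<in> (\<lambda>j::int. \<theta> + j / (2 * (\<beta> d - \<beta> a))) ` UNIV" by blast
  qed
  then have "countable {x. J d a x = 0}"
    by (rule countable_subset) simp
  then have "{x. J d a x = 0} \<in> null_sets lebesgue"
    by (intro null_sets_completionI countable_imp_null_set_lborel)
  then show ?thesis
    by (rule AE_I') auto
qed

text \<open>Here \<open>J p a\<close> is constant and \<open>J b a\<close> has the frequency of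
  \<open>J d a\<close>. Cancellation on the progression kills the constant and gives
  \<open>J b a = \<rho> * J d a\<close>, so \<open>u d = - \<rho> * u b\<close>; the opposite orders
  at the ends force \<open>\<rho> = -1\<close>.\<close>

lemma two_frequencies:
  assumes "\<beta> p = \<beta> a" "\<beta> b = \<beta> d"
  shows "c b \<noteq> 0" "AE x in lebesgue. \<bar>x\<bar> > X \<longrightarrow> u d x = u b x"
proof -
  obtain \<theta> where J0: "\<And>j::int. J d a (\<theta> + j / (2 * (\<beta> d - \<beta> a))) = 0"
    using exists_J_zero by blast
  then have s: "J b a (\<theta> + j / (2 * (\<beta> d - \<beta> a))) + J p a (\<theta> + j / (2 * (\<beta> d - \<beta> a))) = 0" for j :: int
    using J_cancel by blast
  define E D where "E = c b * cnj (c a) * cis (2 * pi * (\<beta> d - \<beta> a) * \<theta>)"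
    and "D = c d * cnj (c a) * cis (2 * pi * (\<beta> d - \<beta> a) * \<theta>)"
  have Jp: "J p a x = Im (c p * cnj (c a))" for x
    by (simp add: J_def assms)
  have Jb: "J b a (\<theta> + t) = Im (E * cis (2 * pi * (\<beta> d - \<beta> a) * t))" for t
    by (simp add: J_def E_def assms cis_mult distrib_left mult.assoc)
  have Jd: "J d a (\<theta> + t) = Im (D * cis (2 * pi * (\<beta> d - \<beta> a) * t))" for t
    by (simp add: J_def D_def assms cis_mult distrib_left mult.assoc)
  have "2 * pi * (\<beta> d - \<beta> a) * (1 / (2 * (\<beta> d - \<beta> a))) = pi"
    using half_period[of "\<beta> d - \<beta> a" 1] freq by simp
  \<comment> \<open>Between \<open>j = 0\<close> and \<open>j = 1\<close> the tone changes sign and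
    the constant does not, so both vanish.\<close>
  then have "Im E = 0" and p0: "Im (c p * cnj (c a)) = 0"
    using s[of 0] s[of 1] unfolding Jp Jb by auto
  have D: "Im D = 0" "Re D \<noteq> 0"
  proof -
    show "Im D = 0" using J0[of 0] Jd[of 0] by simp
    moreover have "D \<noteq> 0" using nz by (simp add: D_def)
    ultimately show "Re D \<noteq> 0" by (auto simp: complex_eq_iff)
  qed
  define \<rho> where "\<rho> = Re E / Re D"
  have Jbd: "J b a x = \<rho> * J d a x" for x
    using Jb[of "x - \<theta>"] Jd[of "x - \<theta>"] D \<open>Im E = 0\<close> by (simp add: \<rho>_def)
  have ae: "AE x in lebesgue. \<bar>x\<bar> > X \<longrightarrow> u d x + \<rho> * u b x = 0"
    using J_relation AE_J_nonzero
  proof eventually_elim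
    case (elim x)
    show ?case
    proof
      assume "\<bar>x\<bar> > X"
      then have "J d a x * (u d x + \<rho> * u b x) = 0"
        using elim(1) p0[folded Jp[of x]] by (simp add: Jbd algebra_simps)
      then show "u d x + \<rho> * u b x = 0" using elim(2) by simp
    qed
  qed
  have pt: "\<exists>x. t * x > X \<and> u d x + \<rho> * u b x = 0" if tt: "t \<in> {1, -1}" for t
  proof -
    obtain x where "t * x > X" "\<bar>x\<bar> > X \<longrightarrow> u d x + \<rho> * u b x = 0"
      using recurrent_point[OF ae zero_less_one tt] by blast
    then show ?thesis using abs_gt tt by blast
  qed
  obtain t :: real where t: "t \<in> {1, - 1}" "\<And>x. t * x > X \<Longrightarrow> u d x \<le> u b x"
    using end_with_order by metis
  obtain x where x: "t * x > X" "u d x + \<rho> * u b x = 0" using pt[OF t(1)] by blast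
  have "(- \<rho>) * u b x \<le> 1 * u b x" using t(2)[OF x(1)] x(2) by simp
  then have r1: "- \<rho> \<le> 1" using pos[OF abs_gt[OF x(1) t(1)], of b] mult_le_cancel_right_pos by blast
  obtain t' :: real where t': "t' \<in> {1, - 1}" "\<And>x. t' * x > X \<Longrightarrow> u b x \<le> u d x"
    using end_with_order by metis
  obtain x' where x': "t' * x' > X" "u d x' + \<rho> * u b x' = 0" using pt[OF t'(1)] by blast
  have "1 * u b x' \<le> (- \<rho>) * u b x'" using t'(2)[OF x'(1)] x'(2) by simp
  then have r2: "1 \<le> - \<rho>" using pos[OF abs_gt[OF x'(1) t'(1)], of b] mult_le_cancel_right_pos by blast
  have r: "\<rho> = -1" using r1 r2 by simp
  then show "AE x in lebesgue. \<bar>x\<bar> > X \<longrightarrow> u d x = u b x"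
    using ae by simp
  show "c b \<noteq> 0"
    using r by (auto simp: \<rho>_def E_def)
qed

end

section \<open>Monotone functions with an almost everywhere period\<close>

text \<open>Monotonicity squeezes \<open>f\<close> between two values that the period makes equal;
  constancy then spreads to the right from one point where the period holds.\<close>

lemma antimono_ae_period_const:
  fixes f :: "real \<Rightarrow> real"
  assumes anti: "\<And>x y. X < x \<Longrightarrow> x \<le> y \<Longrightarrow> f y \<le> f x"
    and \<delta>: "\<delta> > 0" and per: "AE x in lebesgue. x > X \<longrightarrow> f (x + \<delta>) = f x"
  obtains y where "y > X" "\<And>x. y \<le> x \<Longrightarrow> f x = f y"
proof -
  have good: "\<exists>x. l < x \<and> x < r \<and> f (x + \<delta>) = f x" if "X \<le> l" "l < r" for l r
    using AE_lebesgue_open_witness[OF per, of "{l<..<r}"] that by force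
  obtain y where y: "X < y" "f (y + \<delta>) = f y"
    using good[of X "X + 1"] by auto
  \<comment> \<open>Steps of \<open>\<delta> / 2\<close> rather than \<open>\<delta>\<close>: the
    period holds only almost everywhere, and the remaining half is an open interval in which to
    choose a point.\<close>
  have "f (y + \<delta> + real n * (\<delta> / 2)) = f y" for n
  proof (induction n)
    case 0
    then show ?case using y by simp
  next
    case (Suc n)
    define r where "r = real n * (\<delta> / 2)"
    have r: "0 \<le> r" "real (Suc n) * (\<delta> / 2) = r + \<delta> / 2"
      using \<delta> by (auto simp: r_def field_simps)
    have IH: "f (y + \<delta> + r) = f y" using Suc by (simp add: r_def)
    obtain x where x: "y + \<delta> / 2 + r < x" "x < y + \<delta> + r" "f (x + \<delta>) = f x"
      using good[of "y + \<delta> / 2 + r" "y + \<delta> + r"] y \<delta> r by auto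
    have "f (x + \<delta>) \<le> f (y + \<delta> + (r + \<delta> / 2))"
      using x y \<delta> r by (intro anti) linarith+
    moreover have "f (y + \<delta> + r) \<le> f x"
      using x y \<delta> r by (intro anti) linarith+
    moreover have "f (y + \<delta> + (r + \<delta> / 2)) \<le> f y"
      using y \<delta> r by (intro anti) linarith+
    ultimately show ?case unfolding r(2) using IH x(3) by linarith
  qed
  note step = this
  show thesis
  proof (rule that[OF y(1)])
    fix x assume "y \<le> x"
    obtain n where "(x - y) / (\<delta> / 2) < real n" using reals_Archimedean2 by blast
    then have "x \<le> y + \<delta> + real n * (\<delta> / 2)" using \<delta> by (simp add: field_simps)
    then have "f (y + \<delta> + real n * (\<delta> / 2)) \<le> f x"
      using y \<open>y \<le> x\<close> by (intro anti) auto
    then have "f y \<le> f x" using step[of n] by simp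
    then show "f x = f y" using anti[of y x] y \<open>y \<le> x\<close> by simp
  qed
qed

lemma not_integrable_ge_const:
  fixes f :: "real \<Rightarrow> real"
  assumes int: "integrable lebesgue f" and nonneg: "\<And>x. f x \<ge> 0"
    and k: "k > 0" "\<And>x. y \<le> x \<Longrightarrow> k \<le> f x"
  shows False
proof -
  obtain n where n: "integral\<^sup>L lebesgue f / k < real n" using reals_Archimedean2 by blast
  have "(\<integral>x. k * indicator {y..y + real n} x \<partial>lebesgue) \<le> integral\<^sup>L lebesgue f"
  proof (rule integral_mono[OF _ int])
    show "integrable lebesgue (\<lambda>x. k * indicator {y..y + real n} x)"
      by (intro integrable_mult_right integrable_real_indicator) auto
    show "k * indicator {y..y + real n} x \<le> f x" for x
      using k nonneg by (auto simp: indicator_def)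
  qed
  moreover have "(\<integral>x. k * indicator {y..y + real n} x \<partial>lebesgue) = k * real n"
    by simp
  moreover have "integral\<^sup>L lebesgue f < k * real n"
    using n k(1) by (simp add: pos_divide_less_eq mult.commute)
  ultimately show False by linarith
qed

section \<open>Translates of one function\<close>

text \<open>Approached horizontally at distance \<open>t\<close>, a pole grows at least like 1/t,
  but the bound permits only 1/sqrt t. So all singularities of \<open>E / P\<close> are
  removable.\<close>

lemma quotient_entire:
  fixes E P :: "complex \<Rightarrow> complex"
  assumes E: "E holomorphic_on UNIV" and P: "P holomorphic_on UNIV" "P z0 \<noteq> 0"
    and bound: "\<And>s. Re s \<noteq> 0 \<Longrightarrow> cmod (E s) * sqrt \<bar>Re s\<bar> \<le> C * cmod (P s)"
  obtains G where "G holomorphic_on UNIV" "\<And>s. P s * G s = E s"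
    "\<And>s. cmod (G s) * sqrt \<bar>Re s\<bar> \<le> C \<or> Re s = 0"
proof -
  define H where "H = (\<lambda>s. E s / P s)"
  have near: "\<forall>\<^sub>F s in at z. P s \<noteq> 0" for z
    using non_zero_neighbour_alt[OF P(1) open_UNIV connected_UNIV, of z z0] P(2)
    by (auto elim: eventually_mono)
  have HB: "cmod (H s) * sqrt \<bar>Re s\<bar> \<le> C" if "P s \<noteq> 0" "Re s \<noteq> 0" for s
    using bound[of s] that by (simp add: H_def norm_divide field_simps)
  have mero: "H meromorphic_on UNIV"
    unfolding H_def using E P
    by (intro meromorphic_on_divide analytic_on_imp_meromorphic_on) (auto simp: analytic_on_open)
  have nopole: "\<not> is_pole H z" for z
  proof
    assume pole: "is_pole H z"
    \<comment> \<open>The horizontal direction away from the imaginary axis, so that the real part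
      has modulus at least \<open>t\<close> even if \<open>z\<close> lies on the axis.\<close>
    define \<sigma> :: real where "\<sigma> = (if Re z \<ge> 0 then 1 else - 1)"
    obtain S where S: "open S" "z \<in> S" "\<And>s. s \<in> S \<Longrightarrow> s \<noteq> z \<Longrightarrow> P s \<noteq> 0"
      using near[of z] unfolding eventually_at_topological by blast
    have "H holomorphic_on S - {z}"
      unfolding H_def using S
      by (intro holomorphic_intros holomorphic_on_subset[OF E] holomorphic_on_subset[OF P(1)]) auto
    from zorder_exist_pole[OF this S(1,2) pole]
    obtain g n r where g: "(0::nat) < n" "g z \<noteq> 0" "r > 0" "cball z r \<subseteq> S" "g holomorphic_on cball z r"
      "\<And>w. w \<in> cball z r - {z} \<Longrightarrow> H w = g w / (w - z) ^ n"
      by (smt (verit) nat_0_iff zero_less_nat_eq)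
    have lim1: "((\<lambda>t. g (z + of_real (\<sigma> * t))) \<longlongrightarrow> g z) (at_right 0)"
    proof -
      have "isCont g z"
        using holomorphic_on_imp_continuous_on[OF g(5)] g(3)
        by (intro continuous_on_interior[of "cball z r"]) auto
      moreover have "((\<lambda>t. z + of_real (\<sigma> * t)) \<longlongrightarrow> z + of_real (\<sigma> * 0)) (at_right 0)"
        by (intro tendsto_intros)
      ultimately show ?thesis
        using isCont_tendsto_compose by fastforce
    qed
    have small: "\<forall>\<^sub>F t in at_right 0. t < r \<and> t > (0::real)"
      using g(3) by (auto simp: eventually_at_right_field)
    \<comment> \<open>The right side is of order t^(n - 1/2) with \<open>n\<close> at least 1, so it
      tends to 0, against \<open>g z \<noteq> 0\<close>.\<close>
    have "\<forall>\<^sub>F t in at_right 0. cmod (g (z + of_real (\<sigma> * t))) \<le> C * sqrt t * t ^ (n - 1)"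
      using small
    proof eventually_elim
      case (elim t)
      define w where "w = z + of_real (\<sigma> * t)"
      have wz: "w \<in> cball z r - {z}" "cmod (w - z) = t"
        using elim by (auto simp: w_def dist_norm \<sigma>_def)
      have Re: "\<bar>Re w\<bar> \<ge> t" "Re w \<noteq> 0" using elim by (auto simp: w_def \<sigma>_def)
      have Pw: "P w \<noteq> 0" using wz g(4) S(3) by blast
      have "cmod (H w) * sqrt t \<le> cmod (H w) * sqrt \<bar>Re w\<bar>"
        using Re by (intro mult_left_mono) auto
      also have "\<dots> \<le> C" by (rule HB[OF Pw Re(2)])
      finally have 1: "cmod (H w) * sqrt t \<le> C" .
      have "cmod (g w) = cmod (H w) * t ^ n"
        using g(6)[OF wz(1)] wz elim by (auto simp: norm_divide norm_power)
      also have "t ^ n = sqrt t * sqrt t * t ^ (n - 1)"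
        using g(1) elim by (simp add: power_eq_if)
      also have "cmod (H w) * (sqrt t * sqrt t * t ^ (n - 1)) = (cmod (H w) * sqrt t) * (sqrt t * t ^ (n - 1))"
        by simp
      also have "\<dots> \<le> C * (sqrt t * t ^ (n - 1))"
        using 1 elim by (intro mult_right_mono) auto
      finally show ?case by (simp add: w_def)
    qed
    moreover have "((\<lambda>t. C * sqrt t * t ^ (n - 1)) \<longlongrightarrow> C * sqrt 0 * 0 ^ (n - 1)) (at_right (0::real))"
      by (intro tendsto_intros)
    then have "((\<lambda>t. C * sqrt t * t ^ (n - 1)) \<longlongrightarrow> 0) (at_right (0::real))"
      by simp
    ultimately have "((\<lambda>t. g (z + of_real (\<sigma> * t))) \<longlongrightarrow> 0) (at_right 0)"
      by (rule Lim_null_comparison)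
    from tendsto_unique[OF trivial_limit_at_right_real lim1 this] have "g z = 0" .
    then show False using g(2) by simp
  qed
  define G where "G = remove_sings H"
  have Ghol: "G holomorphic_on UNIV"
  proof -
    have "\<not> is_pole G z" for z
    proof -
      have "isolated_singularity_at H z" using mero meromorphic_on_isolated_singularity
        by (meson UNIV_I meromorphic_on_subset subset_UNIV)
      then show ?thesis using nopole[of z] unfolding G_def by simp
    qed
    then have "G analytic_on UNIV"
      using remove_sings_nicely_meromorphic[OF mero] nicely_meromorphic_without_singularities
      unfolding G_def by blast
    then show ?thesis by (rule analytic_imp_holomorphic)
  qed
  have cont: "isCont G s" "isCont E s" "isCont P s" for s
    using holomorphic_on_imp_continuous_on[OF Ghol] holomorphic_on_imp_continuous_on[OF E]
      holomorphic_on_imp_continuous_on[OF P(1)]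
    by (auto simp: continuous_on_eq_continuous_at)
  have GH: "G s = H s" if "P s \<noteq> 0" for s
  proof -
    have "H analytic_on {s}" unfolding H_def
      using that E P(1) by (intro analytic_on_divide) (auto simp: analytic_on_holomorphic)
    then show ?thesis unfolding G_def by simp
  qed
  \<comment> \<open>Both claims hold where \<open>P\<close> is nonzero and extend by continuity, the
    zeros of \<open>P\<close> being isolated.\<close>
  show thesis
  proof (rule that[OF Ghol])
    fix s
    have "\<forall>\<^sub>F w in at s. P w * G w = E w"
      using near[of s] by eventually_elim (simp add: GH H_def)
    moreover have "((\<lambda>w. P w * G w) \<longlongrightarrow> P s * G s) (at s)" and E: "(E \<longlongrightarrow> E s) (at s)"
      using cont by (auto simp: isCont_def intro!: tendsto_mult)
    ultimately have "(E \<longlongrightarrow> P s * G s) (at s)"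
      using Lim_transform_eventually by blast
    then show "P s * G s = E s" using E LIM_unique by blast
  next
    fix s
    show "cmod (G s) * sqrt \<bar>Re s\<bar> \<le> C \<or> Re s = 0"
    proof (cases "Re s = 0")
      case False
      have "((\<lambda>w. cmod (G w) * sqrt \<bar>Re w\<bar>) \<longlongrightarrow> cmod (G s) * sqrt \<bar>Re s\<bar>) (at s)"
        using cont(1)[of s] unfolding isCont_def by (intro tendsto_intros) auto
      moreover have "((\<lambda>w. Re w) \<longlongrightarrow> Re s) (at s)" by (intro tendsto_intros)
      then have "\<forall>\<^sub>F w in at s. Re w \<noteq> 0"
        using False tendsto_imp_eventually_ne by blast
      then have "\<forall>\<^sub>F w in at s. cmod (G w) * sqrt \<bar>Re w\<bar> \<le> C"
        using near[of s] by eventually_elim (simp add: GH HB)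
      ultimately have "cmod (G s) * sqrt \<bar>Re s\<bar> \<le> C"
        by (intro tendsto_upperbound[where F = "at s"]) auto
      then show ?thesis by simp
    qed simp
  qed
qed

text \<open>On the circle \<open>\<bar>s\<bar> = R\<close> one has \<open>\<bar>s\<^sup>2 + R\<^sup>2\<bar> = 2 R \<bar>Re s\<bar>\<close>, which absorbs the
  singularity of the bound on the imaginary axis.\<close>

lemma entire_zero_of_axis_bound:
  assumes G: "G holomorphic_on UNIV"
    and bound: "\<And>s. cmod (G s) * sqrt \<bar>Re s\<bar> \<le> C \<or> Re s = 0"
  shows "G w = 0"
proof -
  have C: "C \<ge> 0"
    using bound[of 1] order_trans[OF _ , of 0 "cmod (G 1)" C] by simp
  have est: "cmod (G w) * (R\<^sup>2 - (cmod w)\<^sup>2) \<le> 2 * R * C * sqrt R" if R: "R > cmod w" for R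
  proof -
    have R0: "R > 0" using R norm_ge_zero[of w] by linarith
    define F where "F = (\<lambda>s. G s * (s\<^sup>2 + of_real (R\<^sup>2)))"
    have hol: "F holomorphic_on A" for A
      unfolding F_def by (intro holomorphic_intros holomorphic_on_subset[OF G]) auto
    have "cmod (F w) \<le> 2 * R * C * sqrt R"
    proof (rule maximum_modulus_frontier[of F "ball 0 R"])
      show "F holomorphic_on interior (ball 0 R)" by (rule hol)
      show "continuous_on (closure (ball 0 R)) F"
        by (rule holomorphic_on_imp_continuous_on[OF hol])
      show "w \<in> ball 0 R" using R by simp
      fix s assume "s \<in> frontier (ball (0::complex) R)"
      then have s: "cmod s = R" using R0 by (simp add: frontier_ball)
      have "s\<^sup>2 + of_real (R\<^sup>2) = s\<^sup>2 + s * cnj s"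
        by (metis complex_norm_square s of_real_power)
      also have "\<dots> = s * (s + cnj s)" by (simp add: power2_eq_square algebra_simps)
      also have "s + cnj s = of_real (2 * Re s)" by (simp add: complex_add_cnj)
      finally have eq: "cmod (F s) = cmod (G s) * (R * (2 * \<bar>Re s\<bar>))"
        by (simp add: F_def norm_mult s)
      show "cmod (F s) \<le> 2 * R * C * sqrt R"
      proof (cases "Re s = 0")
        case True
        then show ?thesis using eq C R0 by simp
      next
        case False
        have "\<bar>Re s\<bar> \<le> R" using abs_Re_le_cmod[of s] s by simp
        then have sq: "sqrt \<bar>Re s\<bar> \<le> sqrt R" by simp
        have "cmod (F s) = 2 * R * ((cmod (G s) * sqrt \<bar>Re s\<bar>) * sqrt \<bar>Re s\<bar>)"
          unfolding eq by simp
        also have "\<dots> \<le> 2 * R * (C * sqrt R)"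
          using bound[of s] False sq C R0 by (intro mult_left_mono mult_mono) auto
        finally show ?thesis by simp
      qed
    qed auto
    moreover have "cmod (F w) \<ge> cmod (G w) * (R\<^sup>2 - (cmod w)\<^sup>2)"
    proof -
      have "R\<^sup>2 - (cmod w)\<^sup>2 = cmod (of_real (R\<^sup>2)) - cmod (- (w\<^sup>2))"
        by (simp add: norm_power)
      also have "\<dots> \<le> cmod (of_real (R\<^sup>2) - - (w\<^sup>2))"
        by (rule norm_triangle_ineq2)
      finally show ?thesis
        unfolding F_def norm_mult by (intro mult_left_mono) (auto simp: add.commute)
    qed
    ultimately show ?thesis by linarith
  qed
  \<comment> \<open>The numerator grows like R^(3/2), the denominator like R^2.\<close>
  have "((\<lambda>R. 2 * R * C * sqrt R / (R\<^sup>2 - (cmod w)\<^sup>2)) \<longlongrightarrow> 0) at_top"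
    by real_asymp
  moreover have "\<forall>\<^sub>F R in at_top. cmod (G w) \<le> 2 * R * C * sqrt R / (R\<^sup>2 - (cmod w)\<^sup>2)"
    using eventually_gt_at_top[of "cmod w"]
  proof eventually_elim
    case (elim R)
    then have "R\<^sup>2 - (cmod w)\<^sup>2 > 0" by (simp add: power_strict_mono)
    then show ?case using est[OF elim] by (simp add: pos_le_divide_eq)
  qed
  ultimately have "cmod (G w) \<le> 0"
    by (intro tendsto_lowerbound[where F = at_top]) auto
  then show ?thesis by simp
qed

lemma numerator_zero_of_axis_bound:
  fixes E P :: "complex \<Rightarrow> complex"
  assumes "E holomorphic_on UNIV" "P holomorphic_on UNIV" "P z0 \<noteq> 0"
    and "\<And>s. Re s \<noteq> 0 \<Longrightarrow> cmod (E s) * sqrt \<bar>Re s\<bar> \<le> C * cmod (P s)"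
  shows "E s = 0"
proof -
  obtain G where "G holomorphic_on UNIV" "\<And>s. P s * G s = E s"
    "\<And>s. cmod (G s) * sqrt \<bar>Re s\<bar> \<le> C \<or> Re s = 0"
    using quotient_entire[OF assms] by blast
  then show ?thesis using entire_zero_of_axis_bound by (metis mult_zero_right)
qed

section \<open>One-sided Laplace transforms of square integrable functions\<close>

lemma has_bochner_integral_exp_half_line:
  fixes \<sigma> :: real
  assumes "\<sigma> > 0"
  shows "has_bochner_integral lborel (\<lambda>t. indicator {0..} t * exp (- (2 * \<sigma> * t))) (1 / (2 * \<sigma>))"
proof (rule has_bochner_integral_nn_integral)
  have "((\<lambda>t. exp (- (2 * \<sigma>) * t)) has_integral exp (- (2 * \<sigma>) * 0) / (2 * \<sigma>)) {0..}"
    by (rule has_integral_exp_minus_to_infinity) (use assms in simp)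
  then have "((\<lambda>t. if t \<in> {0..} then exp (- (2 * \<sigma>) * t) else 0) has_integral 1 / (2 * \<sigma>)) UNIV"
    by (subst has_integral_restrict_UNIV) simp
  moreover have "(\<lambda>t. if t \<in> {0..} then exp (- (2 * \<sigma>) * t) else 0)
      = (\<lambda>t. indicator {0..} t * exp (- (2 * \<sigma> * t)))"
    by (auto simp: indicator_def)
  ultimately show "(\<integral>\<^sup>+ t. ennreal (indicator {0..} t * exp (- (2 * \<sigma> * t))) \<partial>lborel) = ennreal (1 / (2 * \<sigma>))"
    by (intro nn_integral_has_integral_lborel) auto
qed (use assms in \<open>auto intro!: AE_I2\<close>)

lemma has_bochner_integral_exp_half_line_neg:
  fixes \<sigma> :: real
  assumes "\<sigma> < 0"
  shows "has_bochner_integral lborel (\<lambda>t. indicator {..0} t * exp (- (2 * \<sigma> * t))) (1 / (2 * \<bar>\<sigma>\<bar>))"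
proof -
  have "has_bochner_integral lborel (\<lambda>t. indicator {0..} (0 + (- 1) * t) * exp (- (2 * \<bar>\<sigma>\<bar> * (0 + (- 1) * t))))
      (1 / (2 * \<bar>\<sigma>\<bar>) /\<^sub>R \<bar>- 1\<bar>)"
    by (rule lborel_has_bochner_integral_real_affine_iff[THEN iffD1])
      (use has_bochner_integral_exp_half_line[of "\<bar>\<sigma>\<bar>"] assms in auto)
  moreover have "(\<lambda>t. indicator {0..} (0 + (- 1) * t) * exp (- (2 * \<bar>\<sigma>\<bar> * (0 + (- 1) * t))))
      = (\<lambda>t::real. indicator {..0} t * exp (- (2 * \<sigma> * t)))"
    using assms by (auto simp: indicator_def)
  ultimately show ?thesis by simp
qed

text \<open>Cauchy-Schwarz in additive form, from a square being nonnegative. The weight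
  \<open>r\<close> stays free so that it can later be matched to \<open>K\<close>.\<close>

lemma integral_product_bound:
  fixes f h :: "real \<Rightarrow> complex"
  assumes [measurable]: "f \<in> borel_measurable borel" "h \<in> borel_measurable borel"
    and f: "integrable lborel (\<lambda>t. (cmod (f t))\<^sup>2)"
    and W: "has_bochner_integral lborel W K" "\<And>t. (cmod (h t))\<^sup>2 \<le> W t"
  shows "integrable lborel (\<lambda>t. f t * h t)"
    and "r > 0 \<Longrightarrow> cmod (\<integral>t. f t * h t \<partial>lborel) \<le> (r * (\<integral>t. (cmod (f t))\<^sup>2 \<partial>lborel) + K / r) / 2"
proof -
  have pt: "cmod (f t * h t) \<le> (r * (cmod (f t))\<^sup>2 + W t / r) / 2" if "r > 0" for r t
  proof -
    have "0 \<le> (r * cmod (f t) - cmod (h t))\<^sup>2" by simp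
    then have "2 * r * cmod (f t) * cmod (h t) \<le> r * r * (cmod (f t))\<^sup>2 + (cmod (h t))\<^sup>2"
      by (simp add: power2_diff power_mult_distrib power2_eq_square algebra_simps)
    also have "\<dots> \<le> r * r * (cmod (f t))\<^sup>2 + W t" using W(2)[of t] by simp
    finally show ?thesis using that by (simp add: norm_mult field_simps)
  qed
  have iW: "integrable lborel W" "integral\<^sup>L lborel W = K"
    using W(1) by (auto simp: has_bochner_integral_iff)
  have iB: "integrable lborel (\<lambda>t. (r * (cmod (f t))\<^sup>2 + W t / r) / 2)" for r
    using f iW(1) by (intro integrable_divide Bochner_Integration.integrable_add integrable_mult_right)
  show int: "integrable lborel (\<lambda>t. f t * h t)"
  proof (rule Bochner_Integration.integrable_bound[OF iB[of 1]])
    show "AE t in lborel. norm (f t * h t) \<le> norm ((1 * (cmod (f t))\<^sup>2 + W t / 1) / 2)"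
    proof (rule AE_I2)
      fix t
      show "norm (f t * h t) \<le> norm ((1 * (cmod (f t))\<^sup>2 + W t / 1) / 2)"
        using order_trans[OF pt[of 1 t] abs_ge_self] by simp
    qed
  qed measurable
  assume l: "r > 0"
  have "cmod (\<integral>t. f t * h t \<partial>lborel) \<le> (\<integral>t. cmod (f t * h t) \<partial>lborel)"
    by (rule integral_norm_bound)
  also have "\<dots> \<le> (\<integral>t. (r * (cmod (f t))\<^sup>2 + W t / r) / 2 \<partial>lborel)"
    by (intro integral_mono integrable_norm int iB pt l)
  also have "\<dots> = (r * (\<integral>t. (cmod (f t))\<^sup>2 \<partial>lborel) + K / r) / 2"
    using f iW by simp
  finally show "cmod (\<integral>t. f t * h t \<partial>lborel) \<le> (r * (\<integral>t. (cmod (f t))\<^sup>2 \<partial>lborel) + K / r) / 2" .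
qed

text \<open>Bounded support dominates the exponential series by that of
  \<open>cmod s * \<bar>R\<bar>\<close>, so termwise integration yields a power series converging
  everywhere.\<close>

lemma exp_transform_entire:
  fixes \<phi> :: "real \<Rightarrow> complex"
  assumes \<phi>: "integrable lborel \<phi>" and R: "\<And>u. \<phi> u \<noteq> 0 \<Longrightarrow> \<bar>u\<bar> \<le> R"
  shows "(\<lambda>s. \<integral>u. \<phi> u * exp (- s * of_real u) \<partial>lborel) holomorphic_on UNIV"
proof -
  define a where "a = (\<lambda>n. \<integral>u. \<phi> u * (- of_real u) ^ n / of_nat (fact n) \<partial>lborel)"
  have [measurable]: "\<phi> \<in> borel_measurable borel" using \<phi> by auto
  have sums: "(\<lambda>n. a n * (s - 0) ^ n) sums (\<integral>u. \<phi> u * exp (- s * of_real u) \<partial>lborel)" for s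
  proof -
    define F where "F = (\<lambda>n u. \<phi> u * (- of_real u) ^ n / of_nat (fact n) * s ^ n)"
    have bd: "norm (F n u) \<le> norm (\<phi> u) * ((cmod s * \<bar>R\<bar>) ^ n / fact n)" for n u
    proof (cases "\<phi> u = 0")
      case False
      then have "\<bar>u\<bar> ^ n \<le> \<bar>R\<bar> ^ n" using R[of u] by (intro power_mono) auto
      then have "norm (\<phi> u) * (\<bar>u\<bar> ^ n * (cmod s ^ n / fact n)) \<le> norm (\<phi> u) * (\<bar>R\<bar> ^ n * (cmod s ^ n / fact n))"
        by (intro mult_left_mono mult_right_mono) auto
      then show ?thesis
        by (simp add: F_def norm_mult norm_divide norm_power power_mult_distrib mult_ac)
    qed (simp add: F_def)
    have int: "integrable lborel (F n)" for n
    proof (rule Bochner_Integration.integrable_bound)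
      show "integrable lborel (\<lambda>u. norm (\<phi> u) * ((cmod s * \<bar>R\<bar>) ^ n / fact n))"
        using \<phi> by (intro integrable_mult_left integrable_norm)
      show "F n \<in> borel_measurable lborel" unfolding F_def by measurable
      show "AE u in lborel. norm (F n u) \<le> norm (norm (\<phi> u) * ((cmod s * \<bar>R\<bar>) ^ n / fact n))"
        using bd by (auto intro!: AE_I2 simp: abs_mult)
    qed
    have summ: "summable (\<lambda>n. k * ((cmod s * \<bar>R\<bar>) ^ n / fact n))" for k :: real
      using summable_exp[of "cmod s * \<bar>R\<bar>"]
      by (intro summable_mult) (simp add: field_simps)
    have "(\<lambda>n. integral\<^sup>L lborel (F n)) sums (\<integral>u. (\<Sum>n. F n u) \<partial>lborel)"
    proof (rule sums_integral[OF int])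
      show "AE u in lborel. summable (\<lambda>n. norm (F n u))"
        by (intro AE_I2 summable_comparison_test[OF _ summ]) (use bd in auto)
      show "summable (\<lambda>n. \<integral>u. norm (F n u) \<partial>lborel)"
      proof (rule summable_comparison_test[OF _ summ[of "\<integral>u. norm (\<phi> u) \<partial>lborel"]], intro exI allI impI)
        fix n
        have "(\<integral>u. norm (F n u) \<partial>lborel) \<le> (\<integral>u. norm (\<phi> u) * ((cmod s * \<bar>R\<bar>) ^ n / fact n) \<partial>lborel)"
          using \<phi> by (intro integral_mono integrable_norm int integrable_mult_left bd)
        then show "norm (\<integral>u. norm (F n u) \<partial>lborel)
            \<le> (\<integral>u. norm (\<phi> u) \<partial>lborel) * ((cmod s * \<bar>R\<bar>) ^ n / fact n)"
          by simp
      qed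
    qed
    moreover have "(\<Sum>n. F n u) = \<phi> u * exp (- s * of_real u)" for u
    proof -
      have "(\<lambda>n. \<phi> u * ((- s * of_real u) ^ n /\<^sub>R fact n)) sums (\<phi> u * exp (- s * of_real u))"
        by (intro sums_mult exp_converges)
      moreover have "(- s * of_real u) ^ n = (- of_real u) ^ n * s ^ n" for n
        by (metis mult_minus_left mult_minus_right mult.commute power_mult_distrib)
      ultimately have "(\<lambda>n. F n u) sums (\<phi> u * exp (- s * of_real u))"
        by (simp add: F_def scaleR_conv_of_real divide_inverse mult_ac)
      then show ?thesis by (simp add: sums_iff)
    qed
    moreover have "integral\<^sup>L lborel (F n) = a n * (s - 0) ^ n" for n
      unfolding F_def a_def by simp
    ultimately show ?thesis by simp
  qed
  have "(\<lambda>s. \<integral>u. \<phi> u * exp (- s * of_real u) \<partial>lborel) holomorphic_on ball 0 r" for r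
    by (rule power_series_holomorphic[OF sums])
  then have "(\<lambda>s. \<integral>u. \<phi> u * exp (- s * of_real u) \<partial>lborel) field_differentiable (at s)" for s
    by (rule holomorphic_on_imp_differentiable_at[where s = "ball 0 (cmod s + 1)"]) auto
  then show ?thesis
    by (simp add: holomorphic_on_def field_differentiable_at_within)
qed

text \<open>After division by the exponential with the least \<open>\<alpha>\<close>, all other
  terms tend to 0.\<close>

lemma exp_polynomial_eventually_nonzero:
  fixes c :: "nat \<Rightarrow> complex" and \<alpha> :: "nat \<Rightarrow> real"
  assumes K: "finite K" "k0 \<in> K" "c k0 \<noteq> 0" and \<alpha>: "\<And>k. k \<in> K \<Longrightarrow> k \<noteq> k0 \<Longrightarrow> \<alpha> k0 < \<alpha> k"
  shows "\<forall>\<^sub>F x in at_top. (\<Sum>k\<in>K. c k * exp (- of_real x * of_real (\<alpha> k))) \<noteq> 0"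
proof -
  let ?P = "\<lambda>x. \<Sum>k\<in>K. c k * of_real (exp (- (\<alpha> k - \<alpha> k0) * x))"
  have "(?P \<longlongrightarrow> (\<Sum>k\<in>K. if k = k0 then c k else 0)) at_top"
  proof (intro tendsto_sum)
    fix k assume k: "k \<in> K"
    show "((\<lambda>x. c k * of_real (exp (- (\<alpha> k - \<alpha> k0) * x))) \<longlongrightarrow> (if k = k0 then c k else 0)) at_top"
    proof (cases "k = k0")
      case False
      then have "\<alpha> k - \<alpha> k0 > 0" using \<alpha>[OF k] by simp
      then have "((\<lambda>x. exp (- (\<alpha> k - \<alpha> k0) * x)) \<longlongrightarrow> 0) at_top"
        by real_asymp
      from tendsto_mult[OF tendsto_const[of "c k"] tendsto_of_real[OF this]] False
      show ?thesis by simp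
    qed simp
  qed
  also have "(\<Sum>k\<in>K. if k = k0 then c k else 0) = c k0"
    using K by simp
  finally have "\<forall>\<^sub>F x in at_top. ?P x \<noteq> 0"
    using K(3) tendsto_imp_eventually_ne by blast
  then show ?thesis
  proof eventually_elim
    case (elim x)
    have "(\<Sum>k\<in>K. c k * exp (- of_real x * of_real (\<alpha> k))) = exp (- of_real x * of_real (\<alpha> k0)) * ?P x"
      by (auto simp: sum_distrib_left algebra_simps simp flip: exp_of_real exp_add intro!: sum.cong)
    then show ?case using elim by simp
  qed
qed

text \<open>Translation by \<open>\<alpha> k\<close> multiplies a one-sided transform by an
  exponential, up to the transform \<open>I k\<close> of the piece carried across 0. The right
  transform and the negative of the left one thus solve the same equation with entire
  \<open>P\<close> and \<open>E\<close>. The axis bound gives \<open>E = 0\<close>, so the right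
  transform vanishes at a real point, against positivity.\<close>

lemma no_translate_relation:
  fixes f :: "real \<Rightarrow> complex" and c :: "nat \<Rightarrow> complex" and \<alpha> :: "nat \<Rightarrow> real"
  assumes fb [measurable]: "f \<in> borel_measurable borel"
    and f2: "integrable lborel (\<lambda>t. (cmod (f t))\<^sup>2)"
    and K: "finite K" "k0 \<in> K" "c k0 \<noteq> 0"
    and \<alpha>: "\<alpha> k0 = 0" "\<And>k. k \<in> K \<Longrightarrow> k \<noteq> k0 \<Longrightarrow> 0 < \<alpha> k"
    and rel: "AE x in lborel. (\<Sum>k\<in>K. c k * f (x - \<alpha> k)) = 0"
    and pos: "AE x in lborel. x > 0 \<longrightarrow> Re (f x) > 0"
  shows False
proof -
  have \<alpha>0: "\<alpha> k \<ge> 0" if "k \<in> K" for k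
    using \<alpha>(1) \<alpha>(2)[OF that] by (cases "k = k0") auto
  define T where "T = (\<lambda>A s. \<integral>t. f t * (indicator A t * exp (- s * of_real t)) \<partial>lborel)"
  define \<phi> where "\<phi> = (\<lambda>k u. indicator {- \<alpha> k..<0} u * f u)"
  define I where "I = (\<lambda>k s. \<integral>u. \<phi> k u * exp (- s * of_real u) \<partial>lborel)"
  define P where "P = (\<lambda>s. \<Sum>k\<in>K. c k * exp (- s * of_real (\<alpha> k)))"
  define E where "E = (\<lambda>s. - (\<Sum>k\<in>K. c k * exp (- s * of_real (\<alpha> k)) * I k s))"
  define N where "N = (\<integral>t. (cmod (f t))\<^sup>2 \<partial>lborel)"
  have I_hol: "I k holomorphic_on UNIV" if "k \<in> K" for k
    unfolding I_def
  proof (rule exp_transform_entire)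
    have "has_bochner_integral lborel (indicator {- \<alpha> k..<0}) (measure lborel {- \<alpha> k..<0})"
      using \<alpha>0[OF that] by (intro has_bochner_integral_real_indicator) auto
    then have "integrable lborel (\<lambda>u. f u * indicator {- \<alpha> k..<0} u)"
      by (intro integral_product_bound(1) f2) (auto simp: indicator_def)
    then show "integrable lborel (\<phi> k)" by (simp add: \<phi>_def mult.commute)
    show "\<phi> k u \<noteq> 0 \<Longrightarrow> \<bar>u\<bar> \<le> \<alpha> k" for u
      by (auto simp: \<phi>_def indicator_def split: if_splits)
  qed
  have E_hol: "E holomorphic_on UNIV"
    unfolding E_def by (intro holomorphic_intros I_hol)
  have P_hol: "P holomorphic_on UNIV"
    unfolding P_def by (intro holomorphic_intros)
  \<comment> \<open>Both half-planes at once; \<open>\<delta>\<close> is the sign with which the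
    left transform enters.\<close>
  have half: "P s * (\<delta> * T A s) = E s \<and> cmod (T A s) * sqrt \<bar>Re s\<bar> \<le> (N + 1 / 2) / 2
      \<and> integrable lborel (\<lambda>t. f t * (indicator A t * exp (- s * of_real t)))"
    if cs: "Re s > 0 \<and> A = {0..} \<and> \<delta> = 1 \<or> Re s < 0 \<and> A = {..<0} \<and> \<delta> = - 1" for s A \<delta>
  proof -
    define h where "h = (\<lambda>t. indicator A t * exp (- s * of_real t))"
    have [measurable]: "A \<in> sets borel" using cs by auto
    have hm [measurable]: "h \<in> borel_measurable borel" unfolding h_def by measurable
    define W where "W = (\<lambda>t. indicator (if Re s > 0 then {0..} else {..0}) t * exp (- (2 * Re s * t)))"
    have W: "has_bochner_integral lborel W (1 / (2 * \<bar>Re s\<bar>))"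
      using cs has_bochner_integral_exp_half_line[of "Re s"] has_bochner_integral_exp_half_line_neg[of "Re s"]
      by (auto simp: W_def)
    have hW: "(cmod (h t))\<^sup>2 \<le> W t" for t
      using cs by (auto simp: h_def W_def indicator_def norm_mult power2_eq_square simp flip: exp_add)
    have shift2: "integrable lborel (\<lambda>t. (cmod (f (t - x)))\<^sup>2)" for x
      using lborel_integrable_real_affine[OF f2, of 1 "- x"] by simp
    have int: "integrable lborel (\<lambda>t. f (t - x) * h t)" for x
      by (rule integral_product_bound(1)[OF _ hm shift2 W hW]) measurable
    have int0: "integrable lborel (\<lambda>t. f t * h t)" using int[of 0] by simp
    have Th: "T A s = (\<integral>t. f t * h t \<partial>lborel)" by (simp add: T_def h_def)
    have shift: "(\<integral>t. f (t - \<alpha> k) * h t \<partial>lborel) = exp (- s * of_real (\<alpha> k)) * (T A s + \<delta> * I k s)"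
      if k: "k \<in> K" for k
    proof -
      \<comment> \<open>As \<open>\<alpha> k \<ge> 0\<close>, the interval
        \<open>{- \<alpha> k..<0}\<close> is gained by the right half-line and lost by the left
        one.\<close>
      have ind: "indicator A (\<alpha> k + u) = (indicator A u + \<delta> * indicator {- \<alpha> k..<0} u :: complex)" for u
        using cs \<alpha>0[OF k] by (auto simp: indicator_def)
      have pt: "f u * h (\<alpha> k + u) = exp (- s * of_real (\<alpha> k)) *
          (f u * h u + \<delta> * (\<phi> k u * exp (- s * of_real u)))" for u
      proof -
        have "exp (- s * of_real (\<alpha> k + u)) = exp (- s * of_real (\<alpha> k)) * exp (- s * of_real u)"
          by (simp add: algebra_simps flip: exp_add)
        then show ?thesis unfolding h_def \<phi>_def ind by (simp add: algebra_simps)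
      qed
      have i1: "integrable lborel (\<lambda>u. f u * h (\<alpha> k + u))"
        using lborel_integrable_real_affine[OF int[of "\<alpha> k"], of 1 "\<alpha> k"] by simp
      have "integrable lborel (\<lambda>u. exp (s * of_real (\<alpha> k)) * (f u * h (\<alpha> k + u)) - f u * h u)"
        using i1 int0 by (intro Bochner_Integration.integrable_diff integrable_mult_right)
      moreover have "exp (s * of_real (\<alpha> k)) * (f u * h (\<alpha> k + u)) - f u * h u
          = \<delta> * (\<phi> k u * exp (- s * of_real u))" for u
      proof -
        have "exp (s * of_real (\<alpha> k)) * exp (- s * of_real (\<alpha> k)) = 1"
          by (simp flip: exp_add)
        then show ?thesis unfolding pt mult.assoc[symmetric] by simp
      qed
      ultimately have i2: "integrable lborel (\<lambda>u. \<delta> * (\<phi> k u * exp (- s * of_real u)))"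
        by simp
      have "(\<integral>t. f (t - \<alpha> k) * h t \<partial>lborel) = (\<integral>u. f u * h (\<alpha> k + u) \<partial>lborel)"
        by (subst lborel_integral_real_affine[where c = 1 and t = "\<alpha> k"]) auto
      also have "\<dots> = exp (- s * of_real (\<alpha> k)) *
          (\<integral>u. f u * h u + \<delta> * (\<phi> k u * exp (- s * of_real u)) \<partial>lborel)"
        unfolding pt by (rule integral_mult_right_zero)
      also have "(\<integral>u. f u * h u + \<delta> * (\<phi> k u * exp (- s * of_real u)) \<partial>lborel) = T A s + \<delta> * I k s"
        using i2 int0 by (simp add: Th I_def)
      finally show ?thesis .
    qed
    have "0 = (\<integral>t. (\<Sum>k\<in>K. c k * (f (t - \<alpha> k) * h t)) \<partial>lborel)"
    proof -
      have "AE t in lborel. (\<Sum>k\<in>K. c k * (f (t - \<alpha> k) * h t)) = 0"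
        using rel
      proof eventually_elim
        case (elim t)
        have "(\<Sum>k\<in>K. c k * (f (t - \<alpha> k) * h t)) = (\<Sum>k\<in>K. c k * f (t - \<alpha> k)) * h t"
          by (simp add: sum_distrib_right mult.assoc)
        then show ?case using elim by simp
      qed
      then show ?thesis by (simp only: integral_eq_zero_AE)
    qed
    also have "\<dots> = (\<Sum>k\<in>K. c k * (exp (- s * of_real (\<alpha> k)) * (T A s + \<delta> * I k s)))"
      using int by (subst Bochner_Integration.integral_sum) (auto simp: shift)
    also have "\<dots> = P s * T A s - \<delta> * E s"
      by (simp add: P_def E_def sum_distrib_left sum_distrib_right sum.distrib algebra_simps)
    finally have "P s * T A s = \<delta> * E s" by simp
    then have 1: "P s * (\<delta> * T A s) = E s" using cs by auto
    \<comment> \<open>The weight \<open>1 / q\<close> in the product bound makes both of its terms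
      multiples of \<open>1 / q\<close>.\<close>
    define q where "q = sqrt \<bar>Re s\<bar>"
    have q: "q > 0" "\<bar>Re s\<bar> = q * q" using cs by (auto simp: q_def)
    have "cmod (T A s) \<le> (1 / q * N + 1 / (2 * \<bar>Re s\<bar>) / (1 / q)) / 2"
      unfolding Th N_def
      by (rule integral_product_bound(2)[OF fb hm f2 W hW]) (use q in simp)
    also have "\<dots> = (N + 1 / 2) / 2 / q"
      unfolding q(2) using q(1) by (simp add: field_simps)
    finally have 2: "cmod (T A s) * q \<le> (N + 1 / 2) / 2"
      using q by (simp add: pos_le_divide_eq)
    show ?thesis using 1 2 int0 by (simp add: q_def h_def)
  qed
  have bound: "cmod (E s) * sqrt \<bar>Re s\<bar> \<le> (N + 1 / 2) / 2 * cmod (P s)" if ne: "Re s \<noteq> 0" for s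
  proof -
    obtain A \<delta> where cs: "Re s > 0 \<and> A = {0..} \<and> \<delta> = 1 \<or> Re s < 0 \<and> A = {..<0::real} \<and> \<delta> = - (1::complex)"
    proof (cases "Re s > 0")
      case True
      then show thesis using that[of "{0..}" 1] by simp
    next
      case False
      then show thesis using that[of "{..<0}" "- 1"] ne by simp
    qed
    then have \<delta>: "cmod \<delta> = 1" by auto
    have "E s = P s * (\<delta> * T A s)" "cmod (T A s) * sqrt \<bar>Re s\<bar> \<le> (N + 1 / 2) / 2"
      using half[OF cs] by auto
    then have "cmod (E s) * sqrt \<bar>Re s\<bar> = cmod (P s) * (cmod (T A s) * sqrt \<bar>Re s\<bar>)"
      by (simp add: norm_mult \<delta>)
    also have "\<dots> \<le> cmod (P s) * ((N + 1 / 2) / 2)"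
      using half[OF cs] by (intro mult_left_mono) auto
    finally show ?thesis by (simp only: mult.commute)
  qed
  have "\<forall>\<^sub>F x in at_top. P (of_real x) \<noteq> 0"
    unfolding P_def by (rule exp_polynomial_eventually_nonzero[where c = c and \<alpha> = \<alpha>, OF K]) (use \<alpha> in auto)
  then obtain x where x: "x > 0" "P (of_real x) \<noteq> 0"
    using eventually_happens[OF eventually_conj[OF eventually_gt_at_top[of 0]]] by auto
  have "E (of_real x) = 0"
    by (rule numerator_zero_of_axis_bound[OF E_hol P_hol x(2) bound])
  then have T0: "T {0..} (of_real x) = 0"
    using half[of "of_real x" "{0..}" 1] x by simp
  have int: "integrable lborel (\<lambda>t. f t * (indicator {0..} t * exp (- of_real x * of_real t)))"
    using half[of "of_real x" "{0..}" 1] x by simp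
  have Re: "Re (f t * (indicator {0..} t * exp (- of_real x * of_real t))) = Re (f t) * indicator {0..} t * exp (- x * t)" for t
  proof -
    have "exp (- of_real x * of_real t) = complex_of_real (exp (- x * t))"
      by (simp add: exp_of_real flip: of_real_mult of_real_minus)
    then show ?thesis by (simp add: indicator_def)
  qed
  have ireal: "integrable lborel (\<lambda>t. Re (f t) * indicator {0..} t * exp (- x * t))"
    using integrable_Re[OF int] unfolding Re .
  have "(\<integral>t. Re (f t) * indicator {0..} t * exp (- x * t) \<partial>lborel) = 0"
    using integral_Re[OF int] T0 unfolding Re T_def by simp
  \<comment> \<open>Positivity is known only for \<open>t > 0\<close>, while the half-line contains
    0.\<close>
  moreover have nz: "AE t in lborel. t \<noteq> (0::real)"
    by (rule AE_lborel_singleton)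
  have "AE t in lborel. 0 \<le> Re (f t) * indicator {0..} t * exp (- x * t)"
    using pos nz by eventually_elim (auto simp: indicator_def)
  ultimately have "AE t in lborel. Re (f t) * indicator {0..} t * exp (- x * t) = 0"
    using integral_nonneg_eq_0_iff_AE[OF ireal] by blast
  then have "AE t in lborel. \<not> (t > (0::real))"
    using pos by eventually_elim (auto simp: indicator_def split: if_splits)
  then have "AE t in lebesgue. \<not> (t > (0::real))"
    by (rule AE_completion)
  then show False
    using AE_lebesgue_open_witness[of "\<lambda>t. \<not> (t > (0::real))" "{0<..}"] by force
qed

section \<open>Four points\<close>

lemma finite_min_attained:
  fixes f :: "'a \<Rightarrow> real"
  assumes "finite S" "S \<noteq> {}"
  shows "\<exists>k\<in>S. \<forall>x\<in>S. f k \<le> f x"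
  using arg_min_if_finite[OF assms, of f] not_less by blast

lemma AE_lborel_shift:
  fixes t :: real
  assumes "AE x in lborel. P x"
  shows "AE x in lborel. P (t + x)"
proof -
  obtain N where N: "N \<in> null_sets lborel" "{x \<in> space lborel. \<not> P x} \<subseteq> N"
    using assms unfolding eventually_ae_filter by blast
  have [measurable]: "N \<in> sets borel" using N(1) by auto
  have "AE x in lborel. x \<notin> N" using N(1) by (rule AE_not_in)
  then have "AE x in lborel. t + 1 * x \<notin> N"
    by (rule AE_borel_affine[rotated 2]) auto
  then show ?thesis
    by eventually_elim (use N(2) in auto)
qed

lemma AE_lebesgue_shift:
  fixes t :: real
  shows "AE x in lebesgue. P x \<Longrightarrow> AE x in lebesgue. P (t + x)"
  unfolding AE_completion_iff by (rule AE_lborel_shift)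

text \<open>The coincidence is an almost everywhere period of \<open>g\<close> near infinity, so by
  monotonicity \<open>Re (g x)\<close> is eventually a positive constant, against square
  integrability.\<close>

lemma no_ae_coincidence:
  assumes g: "square_integrable g" "ultimately_positive g" "ultimately_decreasing g"
    and ne: "a1 \<noteq> a2" and eq: "AE x in lebesgue. x > X \<longrightarrow> Re (g (x - a1)) = Re (g (x - a2))"
  shows False
proof -
  obtain x0 where x0: "\<And>x. x > x0 \<Longrightarrow> 0 < Re (g x)"
    using g(2) unfolding ultimately_positive_def by blast
  obtain x1 where x1: "antimono_on {x1<..} (\<lambda>x. Re (g x))"
    using g(3) unfolding ultimately_decreasing_def by blast
  have main: False
    if ab: "a < b" and eq: "AE x in lebesgue. x > X \<longrightarrow> Re (g (x - a)) = Re (g (x - b))" for a b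
  proof -
    define Z where "Z = max (X - b) (max x0 x1)"
    have anti: "Re (g y) \<le> Re (g x)" if "Z < x" "x \<le> y" for x y
      using monotone_onD[OF x1, of x y] that by (auto simp: Z_def)
    have per: "AE x in lebesgue. x > Z \<longrightarrow> Re (g (x + (b - a))) = Re (g x)"
      using AE_lebesgue_shift[OF eq, of b]
    proof eventually_elim
      case (elim x)
      have e: "b + x - a = x + (b - a)" "b + x - b = x" by auto
      show ?case using elim unfolding e by (auto simp: Z_def)
    qed
    have "b - a > 0" using ab by simp
    from antimono_ae_period_const[of Z "\<lambda>x. Re (g x)", OF anti this per]
    obtain y where y: "y > Z" "\<And>x. y \<le> x \<Longrightarrow> Re (g x) = Re (g y)"
      by blast
    have "integrable lebesgue (\<lambda>x. (cmod (g x))\<^sup>2)"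
      using g(1) by (simp add: square_integrable_def)
    moreover have "(Re (g y))\<^sup>2 > 0" using x0[of y] y(1) by (auto simp: Z_def)
    moreover have "(Re (g y))\<^sup>2 \<le> (cmod (g x))\<^sup>2" if "y \<le> x" for x
      using y(2)[OF that] by (simp add: cmod_power2)
    ultimately show False
      using not_integrable_ge_const[of "\<lambda>x. (cmod (g x))\<^sup>2" "(Re (g y))\<^sup>2" y] by simp
  qed
  from eq have eq': "AE x in lebesgue. x > X \<longrightarrow> Re (g (x - a2)) = Re (g (x - a1))"
    by eventually_elim auto
  show False
    using main[OF _ eq] main[OF _ eq'] ne by linarith
qed

text \<open>Normalization for \<open>no_translate_relation\<close>: a Borel representative of
  \<open>g\<close>, with the least shift moved to 0 and the origin moved to where positivity
  starts.\<close>

lemma translates_independent: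
  fixes g :: "real \<Rightarrow> complex" and c :: "nat \<Rightarrow> complex" and \<alpha> :: "nat \<Rightarrow> real"
  assumes g: "square_integrable g" "ultimately_positive g"
    and K: "finite K" "K \<noteq> {}" "inj_on \<alpha> K" "\<And>k. k \<in> K \<Longrightarrow> c k \<noteq> 0"
    and rel: "AE x in lebesgue. (\<Sum>k\<in>K. c k * g (x - \<alpha> k)) = 0"
  shows False
proof -
  obtain k0 where k0: "k0 \<in> K" "\<And>k. k \<in> K \<Longrightarrow> \<alpha> k0 \<le> \<alpha> k"
    using finite_min_attained[OF K(1,2), of \<alpha>] by auto
  obtain x0 where x0: "\<And>x. x > x0 \<Longrightarrow> 0 < Re (g x)"
    using g(2) unfolding ultimately_positive_def by blast
  have gm [measurable]: "g \<in> borel_measurable lebesgue" and g2: "integrable lebesgue (\<lambda>x. (cmod (g x))\<^sup>2)"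
    using g(1) by (auto simp: square_integrable_def)
  have "(\<lambda>x. Re (g x)) \<in> borel_measurable lebesgue" by measurable
  from completion_ex_borel_measurable_real[OF this]
  obtain r where r [measurable]: "r \<in> borel_measurable lborel" and r_eq: "AE x in lborel. Re (g x) = r x"
    by blast
  have "(\<lambda>x. Im (g x)) \<in> borel_measurable lebesgue" by measurable
  from completion_ex_borel_measurable_real[OF this]
  obtain i where i [measurable]: "i \<in> borel_measurable lborel" and i_eq: "AE x in lborel. Im (g x) = i x"
    by blast
  define g' where "g' = (\<lambda>x. of_real (r x) + \<i> * of_real (i x))"
  have g'm [measurable]: "g' \<in> borel_measurable borel" unfolding g'_def by measurable
  have eq: "AE x in lborel. g x = g' x"
    using r_eq i_eq by eventually_elim (simp add: g'_def complex_eq_iff)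
  have "integrable lebesgue (\<lambda>x. (cmod (g' x))\<^sup>2)"
  proof (rule Bochner_Integration.integrable_cong_AE_imp[OF g2])
    show "(\<lambda>x. (cmod (g' x))\<^sup>2) \<in> borel_measurable lebesgue"
      by (rule measurable_completion) measurable
    show "AE x in lebesgue. (cmod (g x))\<^sup>2 = (cmod (g' x))\<^sup>2"
      using AE_completion[OF eq] by eventually_elim simp
  qed
  then have g'2: "integrable lborel (\<lambda>x. (cmod (g' x))\<^sup>2)"
    by (subst (asm) integrable_completion) measurable
  define f where "f = (\<lambda>x. g' (x0 + x))"
  show False
  proof (rule no_translate_relation[of f K k0 c "\<lambda>k. \<alpha> k - \<alpha> k0"])
    show "f \<in> borel_measurable borel" unfolding f_def by measurable
    show "integrable lborel (\<lambda>t. (cmod (f t))\<^sup>2)"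
      using lborel_integrable_real_affine[OF g'2, of 1 x0] by (simp add: f_def)
    show "0 < \<alpha> k - \<alpha> k0" if "k \<in> K" "k \<noteq> k0" for k
    proof -
      have "\<alpha> k \<noteq> \<alpha> k0" using inj_onD[OF K(3) _ that(1) k0(1)] that(2) by blast
      with k0(2)[OF that(1)] show ?thesis by simp
    qed
    \<comment> \<open>The relation is used at \<open>x0 + \<alpha> k0 + x\<close>, which turns the
      shift \<open>\<alpha> k\<close> into \<open>\<alpha> k - \<alpha> k0\<close>.\<close>
    have "AE x in lborel. g (x0 + \<alpha> k0 - \<alpha> k + x) = g' (x0 + \<alpha> k0 - \<alpha> k + x)" for k
      by (rule AE_lborel_shift[OF eq])
    then have "AE x in lborel. \<forall>k\<in>K. g (x0 + \<alpha> k0 - \<alpha> k + x) = g' (x0 + \<alpha> k0 - \<alpha> k + x)"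
      using K(1) by (subst AE_ball_countable) (auto intro: countable_finite)
    moreover have "AE x in lborel. (\<Sum>k\<in>K. c k * g (x0 + \<alpha> k0 + x - \<alpha> k)) = 0"
      using rel unfolding AE_completion_iff by (rule AE_lborel_shift)
    ultimately show "AE x in lborel. (\<Sum>k\<in>K. c k * f (x - (\<alpha> k - \<alpha> k0))) = 0"
    proof eventually_elim
      case (elim x)
      have "(\<Sum>k\<in>K. c k * f (x - (\<alpha> k - \<alpha> k0))) = (\<Sum>k\<in>K. c k * g (x0 + \<alpha> k0 + x - \<alpha> k))"
        using elim(1) by (intro sum.cong) (auto simp: f_def algebra_simps)
      then show ?case using elim(2) by simp
    qed
    show "AE x in lborel. 0 < x \<longrightarrow> 0 < Re (f x)"
      using AE_lborel_shift[OF eq, of x0]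
    proof eventually_elim
      case (elim x)
      then show ?case using x0[of "x0 + x"] by (simp add: f_def)
    qed
  qed (use K k0 in auto)
qed

section \<open>From the Gabor system to ordered relations, and the cases for four points\<close>

text \<open>\<open>M\<close> bounds the shifts, so for \<open>\<bar>x\<bar> > Y + M\<close> every
  translate is evaluated where \<open>g\<close> is real, positive and monotone.\<close>

lemma ordered_relation_of_gabor:
  fixes g :: "real \<Rightarrow> complex"
  assumes "ultimately_positive g" "ultimately_decreasing g"
    and "ultimately_positive (\<lambda>x. g (- x))" "ultimately_decreasing (\<lambda>x. g (- x))"
    and \<alpha>: "\<And>k. \<bar>\<alpha> k\<bar> \<le> M"
    and rel: "AE x in lebesgue. (\<Sum>k<4. c k * cis (2 * pi * \<beta> k * x) * g (x - \<alpha> k)) = 0"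
  obtains X where "ordered_relation (\<lambda>k x. Re (g (x - \<alpha> k))) c \<alpha> \<beta> X"
proof -
  obtain x0 x1 where x0: "\<And>x. x > x0 \<Longrightarrow> g x \<in> \<real> \<and> 0 < Re (g x)"
    and x1: "\<And>x. x > x1 \<Longrightarrow> g (- x) \<in> \<real> \<and> 0 < Re (g (- x))"
    using assms(1,3) unfolding ultimately_positive_def by blast
  obtain y0 y1 where y0: "antimono_on {y0<..} (\<lambda>x. Re (g x))"
    and y1: "antimono_on {y1<..} (\<lambda>x. Re (g (- x)))"
    using assms(2,4) unfolding ultimately_decreasing_def by blast
  define Y where "Y = \<bar>x0\<bar> + \<bar>x1\<bar> + \<bar>y0\<bar> + \<bar>y1\<bar>"
  have Y: "x0 \<le> Y" "x1 \<le> Y" "y0 \<le> Y" "y1 \<le> Y" by (auto simp: Y_def)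
  have far: "g (x - \<alpha> k) \<in> \<real> \<and> 0 < Re (g (x - \<alpha> k))" if "\<bar>x\<bar> > Y + M" for x k
  proof (cases "x > 0")
    case True
    then show ?thesis using x0[of "x - \<alpha> k"] \<alpha>[of k] that Y by auto
  next
    case False
    then show ?thesis using x1[of "\<alpha> k - x"] \<alpha>[of k] that Y by auto
  qed
  have "ordered_relation (\<lambda>k x. Re (g (x - \<alpha> k))) c \<alpha> \<beta> (Y + M)"
  proof
    show "0 < Re (g (x - \<alpha> k))" if "\<bar>x\<bar> > Y + M" for x k
      using far[OF that] by blast
    show "Re (g (x - \<alpha> i)) \<le> Re (g (x - \<alpha> j))" if "x > Y + M" "\<alpha> i \<le> \<alpha> j" for x i j
      using monotone_onD[OF y0, of "x - \<alpha> j" "x - \<alpha> i"] \<alpha>[of j] that Y by auto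
    show "Re (g (x - \<alpha> j)) \<le> Re (g (x - \<alpha> i))" if "- x > Y + M" "\<alpha> i \<le> \<alpha> j" for x i j
      using monotone_onD[OF y1, of "\<alpha> i - x" "\<alpha> j - x"] \<alpha>[of i] that Y by auto
    show "AE x in lebesgue. \<bar>x\<bar> > Y + M \<longrightarrow>
        (\<Sum>k<4. c k * cis (2 * pi * \<beta> k * x) * of_real (Re (g (x - \<alpha> k)))) = 0"
      using rel
    proof eventually_elim
      case (elim x)
      have "of_real (Re (g (x - \<alpha> k))) = g (x - \<alpha> k)" if "\<bar>x\<bar> > Y + M" for k
        using far[OF that] of_real_Re by blast
      with elim show ?case by simp
    qed
  qed
  then show thesis using that by blast
qed

text \<open>Conjugation exchanges lowest and highest frequency and leaves \<open>u\<close> alone, so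
  \<open>no_inner_frequencies\<close> also covers middle frequencies above the lowest.\<close>

lemma (in ordered_relation) ordered_relation_cnj:
  "ordered_relation u (\<lambda>k. cnj (c k)) \<alpha> (\<lambda>k. - \<beta> k) X"
proof
  show "AE x in lebesgue. \<bar>x\<bar> > X \<longrightarrow>
      (\<Sum>k<4. cnj (c k) * cis (2 * pi * - \<beta> k * x) * of_real (u k x)) = 0"
    using rel
  proof eventually_elim
    case (elim x)
    have "(\<Sum>k<4. cnj (c k) * cis (2 * pi * - \<beta> k * x) * of_real (u k x))
        = cnj (\<Sum>k<4. c k * cis (2 * pi * \<beta> k * x) * of_real (u k x))"
      by (simp add: cis_cnj)
    then show ?case using elim by (metis complex_cnj_zero)
  qed
qed (use pos right left in auto)

theorem theorem5p6:
  fixes g :: "real \<Rightarrow> complex" and \<alpha> \<beta> :: "nat \<Rightarrow> real"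
  assumes "square_integrable g"
    and "ultimately_positive g" and "ultimately_decreasing g"
    and "ultimately_positive (\<lambda>x. g (- x))" and "ultimately_decreasing (\<lambda>x. g (- x))"
    and "inj_on (\<lambda>k. (\<alpha> k, \<beta> k)) {0..3}"
  shows "gabor_independent g \<alpha> \<beta> {0..3}"
  unfolding gabor_independent_def
proof (intro allI impI, rule ccontr)
  fix c :: "nat \<Rightarrow> complex"
  assume rel0: "AE x in lebesgue. (\<Sum>k\<in>{0..3}. c k * gabor_atom g (\<alpha> k) (\<beta> k) x) = 0"
    and nz: "\<not> (\<forall>k\<in>{0..3}. c k = 0)"
  have idx: "{0..3} = {..<4::nat}" by auto
  have inj: "\<alpha> i \<noteq> \<alpha> j" if "i < 4" "j < 4" "i \<noteq> j" "\<beta> i = \<beta> j" for i j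
    using inj_onD[OF assms(6), of i j] that by auto
  have atom: "gabor_atom g a b x = cis (2 * pi * b * x) * g (x - a)" for a b x
    by (simp add: gabor_atom_def cis_conv_exp mult_ac)
  have rel: "AE x in lebesgue. (\<Sum>k<4. c k * cis (2 * pi * \<beta> k * x) * g (x - \<alpha> k)) = 0"
    using rel0 unfolding idx atom by (simp add: mult.assoc)
  define S where "S = {k. k < 4 \<and> c k \<noteq> 0}"
  have S: "finite S" "S \<noteq> {}" "S \<subseteq> {..<4}" using nz unfolding idx S_def by auto
  obtain a where a: "a \<in> S" "\<And>k. k \<in> S \<Longrightarrow> \<beta> a \<le> \<beta> k"
    using finite_min_attained[OF S(1,2), of \<beta>] by auto
  obtain d where d: "d \<in> S" "\<And>k. k \<in> S \<Longrightarrow> \<beta> k \<le> \<beta> d"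
    using finite_min_attained[OF S(1,2), of "\<lambda>k. - \<beta> k"] by auto
  show False
  proof (cases "\<beta> a = \<beta> d")
    case True
    then have const: "\<beta> k = \<beta> a" if "k \<in> S" for k using a(2)[OF that] d(2)[OF that] by simp
    have "AE x in lebesgue. (\<Sum>k\<in>S. c k * g (x - \<alpha> k)) = 0"
      using rel
    proof eventually_elim
      case (elim x)
      have "0 = (\<Sum>k\<in>S. c k * cis (2 * pi * \<beta> k * x) * g (x - \<alpha> k))"
        unfolding elim[symmetric] by (rule sum.mono_neutral_right) (auto simp: S_def)
      also have "\<dots> = cis (2 * pi * \<beta> a * x) * (\<Sum>k\<in>S. c k * g (x - \<alpha> k))"
        by (auto simp: sum_distrib_left const mult_ac intro!: sum.cong)
      finally show ?case by simp
    qed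
    \<comment> \<open>Distinct points with a common frequency have distinct shifts.\<close>
    moreover have "inj_on \<alpha> S"
    proof (rule inj_onI, rule ccontr)
      fix i j assume ij: "i \<in> S" "j \<in> S" "\<alpha> i = \<alpha> j" "i \<noteq> j"
      then have "i < 4" "j < 4" "\<beta> i = \<beta> j" using S(3) const by auto
      with inj ij show False by blast
    qed
    ultimately show False
      using translates_independent[OF assms(1,2) S(1,2)] by (auto simp: S_def)
  next
    case False
    then have ad: "\<beta> a < \<beta> d" "a \<noteq> d" using a(2)[OF d(1)] by auto
    have "card ({..<4} - {a, d}) = 2"
      using S(3) a(1) d(1) ad by (subst card_Diff_subset) auto
    then obtain b p where bp: "{..<4} - {a, d} = {b, p}" "b \<noteq> p"
      by (auto simp: card_2_iff)
    have idx4: "{..<4} = {a, b, p, d}"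
      using bp(1) S(3) a(1) d(1) by blast
    have dist: "distinct [a, b, p, d]"
      using bp ad by auto
    \<comment> \<open>The shifts must be bounded over all natural indices, so those from 4 on are
      set to 0.\<close>
    define \<alpha>' where "\<alpha>' = (\<lambda>k. if k < 4 then \<alpha> k else 0)"
    \<comment> \<open>Indices with \<open>c k = 0\<close> get a harmless frequency between the extreme ones.\<close>
    define \<beta>' where "\<beta>' = (\<lambda>k. if c k = 0 then \<beta> a else \<beta> k)"
    have ends: "\<beta>' a = \<beta> a" "\<beta>' d = \<beta> d" "c a \<noteq> 0" "c d \<noteq> 0"
      using a(1) d(1) by (auto simp: \<beta>'_def S_def)
    have between: "\<beta> a \<le> \<beta>' k" "\<beta>' k \<le> \<beta> d" if "k < 4" for k
      using a(2)[of k] d(2)[of k] ad that by (auto simp: \<beta>'_def S_def)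
    have le: "\<bar>\<alpha>' k\<bar> \<le> (\<Sum>k<4. \<bar>\<alpha> k\<bar>)" for k
      unfolding \<alpha>'_def by (auto intro!: member_le_sum sum_nonneg)
    have rel': "AE x in lebesgue. (\<Sum>k<4. c k * cis (2 * pi * \<beta>' k * x) * g (x - \<alpha>' k)) = 0"
      using rel
    proof eventually_elim
      case (elim x)
      have "(\<Sum>k<4. c k * cis (2 * pi * \<beta>' k * x) * g (x - \<alpha>' k))
          = (\<Sum>k<4. c k * cis (2 * pi * \<beta> k * x) * g (x - \<alpha> k))"
        by (intro sum.cong) (auto simp: \<alpha>'_def \<beta>'_def)
      then show ?case using elim by simp
    qed
    obtain X where X: "ordered_relation (\<lambda>k x. Re (g (x - \<alpha>' k))) c \<alpha>' \<beta>' X"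
      using ordered_relation_of_gabor[OF assms(2-5) le rel'] by blast
    have R1: "ordered_relation4 (\<lambda>k x. Re (g (x - \<alpha>' k))) c \<alpha>' \<beta>' X a b p d"
      using X dist idx4 ends ad unfolding ordered_relation4_def ordered_relation4_axioms_def by auto
    have R2: "ordered_relation4 (\<lambda>k x. Re (g (x - \<alpha>' k))) c \<alpha>' \<beta>' X a p b d"
      using X dist idx4 ends ad unfolding ordered_relation4_def ordered_relation4_axioms_def by auto
    have R3: "ordered_relation4 (\<lambda>k x. Re (g (x - \<alpha>' k))) (\<lambda>k. cnj (c k)) \<alpha>' (\<lambda>k. - \<beta>' k) X d b p a"
      using ordered_relation.ordered_relation_cnj[OF X] dist idx4 ends ad
      unfolding ordered_relation4_def ordered_relation4_axioms_def by auto
    have lt: "b < 4" "p < 4" "d < 4"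
      using ordered_relation4.idx_less[OF R1] by auto
    \<comment> \<open>One middle frequency at each extreme: \<open>c q \<noteq> 0\<close> ensures
      that \<open>q\<close> and \<open>d\<close> truly share a frequency, so their shifts differ
      although the translates agree.\<close>
    have two: False
      if R: "ordered_relation4 (\<lambda>k x. Re (g (x - \<alpha>' k))) c \<alpha>' \<beta>' X a q r d"
        and "\<beta>' q = \<beta> d" "\<beta>' r = \<beta> a" "q < 4" "q \<noteq> d" for q r
    proof -
      have q: "c q \<noteq> 0" and eq: "AE x in lebesgue. \<bar>x\<bar> > X \<longrightarrow> Re (g (x - \<alpha>' d)) = Re (g (x - \<alpha>' q))"
        using ordered_relation4.two_frequencies[OF R] that(2,3) ends by auto
      then have ne: "\<alpha>' d \<noteq> \<alpha>' q"
        using inj[of d q] that lt by (auto simp: \<alpha>'_def \<beta>'_def)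
      from eq have "AE x in lebesgue. x > X \<longrightarrow> Re (g (x - \<alpha>' d)) = Re (g (x - \<alpha>' q))"
        by eventually_elim auto
      then show False
        by (rule no_ae_coincidence[OF assms(1-3) ne])
    qed
    \<comment> \<open>No middle frequency is highest, or none is lowest, or one sits at each
      extreme.\<close>
    consider "\<beta>' b < \<beta> d" "\<beta>' p < \<beta> d" | "\<beta> a < \<beta>' b" "\<beta> a < \<beta>' p"
      | "\<beta>' b = \<beta> d" "\<beta>' p = \<beta> a" | "\<beta>' p = \<beta> d" "\<beta>' b = \<beta> a"
      using between[OF lt(1)] between[OF lt(2)] ad(1) by linarith
    then show False
    proof cases
      case 1
      then show False
        using ordered_relation4.no_inner_frequencies[OF R1] between lt ends by simp
    next
      case 2
      then show False
        using ordered_relation4.no_inner_frequencies[OF R3] between lt ends by simp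
    next
      case 3
      then show False using two[OF R1] lt dist by auto
    next
      case 4
      then show False using two[OF R2] lt dist by auto
    qed
  qed
qed

end
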